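(* Let $X$ be a proper geodesic $\mathrm{CAT}(-1)$ metric space and $\Gamma$ a discrete group of isometries of $X$, with critical exponent $\delta$. Let $\Gamma_0$ be a convex-cocompact subgroup of infinite index in $\Gamma$, and let $C_0=\mathscr{C}\Gamma_0$ be the convex hull of its limit set. Let $C_\infty$ be a nonempty closed convex subset of $X$, with stabilizer $\Gamma_\infty$ in $\Gamma$, and let $\delta_\infty$ be the critical exponent of $\Gamma_\infty$. Assume that $C_\infty$ does not contain $\mathscr{C}\Gamma$, that $\Gamma_\infty\backslash\partial C_\infty$ is compact, and that $C_\infty\cap\gamma C_0$ is nonempty only for a finite set of double classes $[\gamma]\in\Gamma_\infty\backslash\Gamma/\Gamma_0$. For every double class $r=[\gamma]\in\Gamma_\infty\backslash\Gamma/\Gamma_0$, let $D(r)=d(C_\infty,\gamma C_0)$ (which does not depend on the representative). If $\operatorname{Card}\{\gamma\in\Gamma\;:\;d(x,\gamma y)\leq t\}\asymp e^{\delta t}$ for some (equivalently any) $x,y\in X$, and if $\delta_\infty<\delta$, then $$\operatorname{Card}\{r\in\Gamma_\infty\backslash\Gamma/\Gamma_0\;:\;D(r)\leq t\}\;\asymp\;e^{\delta t}.$$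
   Context: For functions $f,g$ of $t$, $f\asymp g$ means that there are constants $c\geq1$ and $t_0$ with $\frac1c f(t)\leq g(t)\leq c f(t)$ for all $t\geq t_0$. The critical exponent of a discrete group $\Gamma'$ of isometries of $X$ is $\limsup_{t\to+\infty}\frac1t\log\operatorname{Card}\{\gamma\in\Gamma'\;:\;d(x,\gamma y)\leq t\}$, for any fixed $x,y\in X$. $\Lambda\Gamma'\subset\partial_\infty X$ is the limit set of $\Gamma'$ and, when $\Lambda\Gamma'$ contains at least two points, $\mathscr{C}\Gamma'\subset X$ is the convex hull of $\Lambda\Gamma'$. The subgroup $\Gamma_0$ is convex-cocompact if $\Lambda\Gamma_0$ contains at least two points and the quotient of $\mathscr{C}\Gamma_0$ by $\Gamma_0$ is compact. *)

theory Defs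
  imports "HOL-Analysis.Analysis" "HOL-Algebra.Coset"
begin

text \<open>
  The space \<open>X\<close> is the universe of a type of class \<open>heine_borel\<close>. For metric spaces this class says
  exactly that every bounded sequence has a convergent subsequence, i.e. that closed balls are
  compact, so it is the class of proper metric spaces.
\<close>

section \<open>Geodesics and the \<open>CAT(-1)\<close> condition\<close>

definition geodesic_segment :: "(real \<Rightarrow> 'a::metric_space) \<Rightarrow> 'a \<Rightarrow> 'a \<Rightarrow> bool" where
  "geodesic_segment c x y \<longleftrightarrow> c 0 = x \<and> c (dist x y) = y \<and>
     (\<forall>s\<in>{0..dist x y}. \<forall>t\<in>{0..dist x y}. dist (c s) (c t) = \<bar>s - t\<bar>)"

definition geodesic_ray :: "(real \<Rightarrow> 'a::metric_space) \<Rightarrow> bool" where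
  "geodesic_ray c \<longleftrightarrow> (\<forall>s\<ge>0. \<forall>t\<ge>0. dist (c s) (c t) = \<bar>s - t\<bar>)"

definition geodesic_line :: "(real \<Rightarrow> 'a::metric_space) \<Rightarrow> bool" where
  "geodesic_line c \<longleftrightarrow> (\<forall>s t. dist (c s) (c t) = \<bar>s - t\<bar>)"

definition geodesic_space :: "'a::metric_space itself \<Rightarrow> bool" where
  "geodesic_space _ \<longleftrightarrow> (\<forall>x y :: 'a. \<exists>c. geodesic_segment c x y)"

definition geodesically_convex :: "'a::metric_space set \<Rightarrow> bool" where
  "geodesically_convex C \<longleftrightarrow>
     (\<forall>x\<in>C. \<forall>y\<in>C. \<forall>c. geodesic_segment c x y \<longrightarrow> c ` {0..dist x y} \<subseteq> C)"

text \<open>The hyperbolic plane of curvature \<open>-1\<close>, in the upper half-plane model.\<close>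

definition hyp_plane :: "complex set" where
  "hyp_plane = {z. Im z > 0}"

definition hyp_dist :: "complex \<Rightarrow> complex \<Rightarrow> real" where
  "hyp_dist z w = arcosh (1 + (cmod (z - w))\<^sup>2 / (2 * Im z * Im w))"

definition comparison_triangle ::
  "'a::metric_space \<Rightarrow> 'a \<Rightarrow> 'a \<Rightarrow> complex \<Rightarrow> complex \<Rightarrow> complex \<Rightarrow> bool" where
  "comparison_triangle x y z x' y' z' \<longleftrightarrow>
     x' \<in> hyp_plane \<and> y' \<in> hyp_plane \<and> z' \<in> hyp_plane \<and>
     hyp_dist x' y' = dist x y \<and> hyp_dist y' z' = dist y z \<and> hyp_dist x' z' = dist x z"

text \<open>\<open>p'\<close> is the point of the hyperbolic segment from \<open>x'\<close> to \<open>y'\<close> corresponding to a point \<open>p\<close> on a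
  geodesic segment from \<open>x\<close> to \<open>y\<close> (in the hyperbolic plane a point of the segment is determined by its
  distances to the two ends).\<close>

definition comparison_point ::
  "'a::metric_space \<Rightarrow> 'a \<Rightarrow> complex \<Rightarrow> complex \<Rightarrow> 'a \<Rightarrow> complex \<Rightarrow> bool" where
  "comparison_point x y x' y' p p' \<longleftrightarrow>
     p' \<in> hyp_plane \<and> hyp_dist x' p' = dist x p \<and> hyp_dist p' y' = dist p y"

text \<open>Two points of a geodesic triangle lying on different sides lie, after relabelling the
  vertices, on the two sides issuing from \<open>x\<close>; two points on the same side have the same distance as
  their comparison points.\<close>

definition cat_minus_one :: "'a::metric_space itself \<Rightarrow> bool" where
  "cat_minus_one _ \<longleftrightarrow>
     (\<forall>(x::'a) y z a b x' y' z' p' q'. \<forall>s\<in>{0..dist x y}. \<forall>t\<in>{0..dist x z}.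
        geodesic_segment a x y \<longrightarrow> geodesic_segment b x z \<longrightarrow>
        comparison_triangle x y z x' y' z' \<longrightarrow>
        comparison_point x y x' y' (a s) p' \<longrightarrow> comparison_point x z x' z' (b t) q' \<longrightarrow>
        dist (a s) (b t) \<le> hyp_dist p' q')"

section \<open>The boundary at infinity\<close>

definition asymptotic :: "((real \<Rightarrow> 'a::metric_space) \<times> (real \<Rightarrow> 'a)) set" where
  "asymptotic = {(c, c'). geodesic_ray c \<and> geodesic_ray c' \<and>
     bounded ((\<lambda>t. dist (c t) (c' t)) ` {0..})}"

definition boundary_at_infinity :: "(real \<Rightarrow> 'a::metric_space) set set" where
  "boundary_at_infinity = Collect geodesic_ray // asymptotic"

text \<open>The trace on \<open>X\<close> of the basic neighbourhood \<open>U(c,r,\<epsilon>)\<close> of the end point of the ray \<open>c\<close> in the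
  cone topology of the compactification: the point \<open>g r\<close> is the projection of \<open>x\<close> to the closed ball of
  radius \<open>r\<close> around \<open>c 0\<close>. For a fixed \<open>c\<close> these form a neighbourhood basis.\<close>

definition cone_nbhd :: "(real \<Rightarrow> 'a::metric_space) \<Rightarrow> real \<Rightarrow> real \<Rightarrow> 'a set" where
  "cone_nbhd c r \<epsilon> = {x. dist (c 0) x > r \<and>
     (\<exists>g. geodesic_segment g (c 0) x \<and> dist (g r) (c r) < \<epsilon>)}"

text \<open>The points at infinity in the closure of an orbit. The choice of the orbit and of the ray \<open>c\<close>
  towards \<open>\<xi>\<close> is immaterial.\<close>

definition limit_set :: "('a::metric_space \<Rightarrow> 'a) set \<Rightarrow> (real \<Rightarrow> 'a) set set" where
  "limit_set G = {\<xi> \<in> boundary_at_infinity.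
     \<forall>x. \<forall>c\<in>\<xi>. \<forall>r>0. \<forall>\<epsilon>>0. \<exists>g\<in>G. g x \<in> cone_nbhd c r \<epsilon>}"

definition line_joins ::
  "(real \<Rightarrow> 'a::metric_space) \<Rightarrow> (real \<Rightarrow> 'a) set \<Rightarrow> (real \<Rightarrow> 'a) set \<Rightarrow> bool" where
  "line_joins c \<xi> \<eta> \<longleftrightarrow> geodesic_line c \<and> (\<lambda>t. c (- t)) \<in> \<xi> \<and> c \<in> \<eta>"

text \<open>The convex hull in \<open>X\<close> of a set of points at infinity: the smallest closed convex subset
  containing every geodesic line with both end points in that set.\<close>

definition hull_at_infinity :: "(real \<Rightarrow> 'a::metric_space) set set \<Rightarrow> 'a set" where
  "hull_at_infinity A = (\<lambda>C. closed C \<and> geodesically_convex C) hull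
     (\<Union>{range c | c. \<exists>\<xi>\<in>A. \<exists>\<eta>\<in>A. line_joins c \<xi> \<eta>})"

definition limit_hull :: "('a::metric_space \<Rightarrow> 'a) set \<Rightarrow> 'a set" where
  "limit_hull G = hull_at_infinity (limit_set G)"

section \<open>Groups of isometries\<close>

definition isometry_group :: "('a::metric_space \<Rightarrow> 'a) monoid" where
  "isometry_group = \<lparr>carrier = {f. bij f \<and> (\<forall>x y. dist (f x) (f y) = dist x y)},
     mult = (\<circ>), one = id\<rparr>"

text \<open>Discreteness with respect to the compact-open topology, i.e. to uniform convergence on compact
  sets.\<close>

definition discrete_isometries :: "('a::metric_space \<Rightarrow> 'a) set \<Rightarrow> bool" where
  "discrete_isometries G \<longleftrightarrow>
     (\<forall>g\<in>G. \<exists>K. compact K \<and> (\<exists>\<epsilon>>0. \<forall>h\<in>G. (\<forall>x\<in>K. dist (g x) (h x) < \<epsilon>) \<longrightarrow> h = g))"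

definition orbit_count :: "('a::metric_space \<Rightarrow> 'a) set \<Rightarrow> 'a \<Rightarrow> 'a \<Rightarrow> real \<Rightarrow> real" where
  "orbit_count G x y t = real (card {g \<in> G. dist x (g y) \<le> t})"

definition critical_exponent :: "('a::metric_space \<Rightarrow> 'a) set \<Rightarrow> 'a \<Rightarrow> 'a \<Rightarrow> ereal" where
  "critical_exponent G x y = Limsup at_top (\<lambda>t::real. ereal (ln (orbit_count G x y t) / t))"

definition set_stabilizer :: "('a \<Rightarrow> 'a) set \<Rightarrow> 'a set \<Rightarrow> ('a \<Rightarrow> 'a) set" where
  "set_stabilizer G C = {g \<in> G. g ` C = C}"

text \<open>The quotient \<open>G\S\<close> of an invariant subset \<open>S\<close> of \<open>X\<close>, with the quotient topology.\<close>

definition orbit_of :: "('a \<Rightarrow> 'a) set \<Rightarrow> 'a \<Rightarrow> 'a set" where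
  "orbit_of G x = (\<lambda>g. g x) ` G"

definition orbit_space :: "('a::topological_space \<Rightarrow> 'a) set \<Rightarrow> 'a set \<Rightarrow> 'a set topology" where
  "orbit_space G S = topology (\<lambda>U. U \<subseteq> orbit_of G ` S \<and>
     openin (top_of_set S) {x \<in> S. orbit_of G x \<in> U})"

lemma openin_orbit_space:
  "openin (orbit_space G S) U \<longleftrightarrow> U \<subseteq> orbit_of G ` S \<and>
     openin (top_of_set S) {x \<in> S. orbit_of G x \<in> U}"
proof -
  let ?L = "\<lambda>U. U \<subseteq> orbit_of G ` S \<and> openin (top_of_set S) {x \<in> S. orbit_of G x \<in> U}"
  have "istopology ?L"
    unfolding istopology_def
  proof (intro conjI allI impI)
    fix U V assume "?L U" "?L V"
    moreover have "{x \<in> S. orbit_of G x \<in> U \<inter> V} =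
        {x \<in> S. orbit_of G x \<in> U} \<inter> {x \<in> S. orbit_of G x \<in> V}" by auto
    ultimately show "openin (top_of_set S) {x \<in> S. orbit_of G x \<in> U \<inter> V}"
      by (metis (no_types, lifting) openin_Int)
  next
    fix \<U> assume "\<forall>U\<in>\<U>. ?L U"
    moreover have "{x \<in> S. orbit_of G x \<in> \<Union>\<U>} =
        \<Union>((\<lambda>U. {x \<in> S. orbit_of G x \<in> U}) ` \<U>)" by auto
    ultimately show "openin (top_of_set S) {x \<in> S. orbit_of G x \<in> \<Union>\<U>}"
      by (metis (no_types, lifting) imageE openin_Union)
  qed auto
  then show ?thesis
    unfolding orbit_space_def by (simp add: topology_inverse')
qed

definition convex_cocompact :: "('a::metric_space \<Rightarrow> 'a) set \<Rightarrow> bool" where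
  "convex_cocompact G \<longleftrightarrow> (\<exists>\<xi>\<in>limit_set G. \<exists>\<eta>\<in>limit_set G. \<xi> \<noteq> \<eta>) \<and>
     compact_space (orbit_space G (limit_hull G))"

section \<open>Double classes and counting\<close>

definition double_classes ::
  "('a::metric_space \<Rightarrow> 'a) set \<Rightarrow> ('a \<Rightarrow> 'a) set \<Rightarrow> ('a \<Rightarrow> 'a) set \<Rightarrow> ('a \<Rightarrow> 'a) set set" where
  "double_classes H G K =
     (\<lambda>g. (H #>\<^bsub>isometry_group\<^esub> g) <#>\<^bsub>isometry_group\<^esub> K) ` G"

text \<open>The common value of \<open>d(C, \<gamma> C\<^sub>0)\<close> over all representatives \<open>\<gamma>\<close> of the class \<open>r\<close>.\<close>

definition class_distance ::
  "'a::metric_space set \<Rightarrow> 'a set \<Rightarrow> ('a \<Rightarrow> 'a) set \<Rightarrow> real" where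
  "class_distance C C\<^sub>0 r = (THE d. \<forall>\<gamma>\<in>r. setdist C (\<gamma> ` C\<^sub>0) = d)"

definition same_growth :: "(real \<Rightarrow> real) \<Rightarrow> (real \<Rightarrow> real) \<Rightarrow> bool"  (infix \<open>\<asymp>\<close> 50) where
  "f \<asymp> g \<longleftrightarrow> (\<exists>c\<ge>1. \<exists>t\<^sub>0. \<forall>t\<ge>t\<^sub>0. 1 / c * f t \<le> g t \<and> g t \<le> c * f t)"

end

theory Submission
  imports Defs
begin

text \<open>
  Stewart's identity in a comparison triangle gives Gromov's four point inequality, and everything
  but one step is a computation with Gromov products. The exception needs negative curvature
  itself: a line whose two ends stay close to a closed convex set lies in it. So a line in the hull
  of \<open>\<Lambda>\<Gamma>\<close> that leaves \<open>C\<^sub>\<infinity>\<close> has an end diverging from \<open>C\<^sub>\<infinity>\<close>, and some \<open>g \<in> \<Gamma>\<close> move the base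
  point far away in a direction with bounded Gromov product with \<open>C\<^sub>\<infinity>\<close>; infinite index gives the
  same for \<open>C\<^sub>0\<close>. Infinite index also prevents \<open>\<Gamma>\<close> from fixing a point at infinity (otherwise
  arbitrarily many cosets \<open>\<gamma>\<Gamma>\<^sub>0\<close> would have orbit points within a uniform distance of each other), and
  a ping-pong argument then turns every \<open>\<gamma>\<close>, by multiplication on both sides by elements of a finite
  set, into an element \<open>g\<close> for which all paths from \<open>C\<^sub>\<infinity>\<close> to \<open>g C\<^sub>0\<close> nearly pass through the base
  point \<open>x\<close> and through \<open>g x\<close>. For such \<open>g\<close> the distance \<open>d(C\<^sub>\<infinity>, g C\<^sub>0)\<close> is \<open>d(x, g x)\<close> up to a
  constant, and only boundedly many of them lie in the same double class; this is the lower bound.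
  For the upper bound, a nearly shortest segment from \<open>C\<^sub>\<infinity>\<close> to \<open>\<gamma> C\<^sub>0\<close> crosses the frontier of
  \<open>C\<^sub>\<infinity>\<close>, and cocompactness yields a representative moving \<open>x\<close> by at most \<open>d(C\<^sub>\<infinity>, \<gamma> C\<^sub>0)\<close> plus a
  constant.
\<close>

section \<open>Comparison with the hyperbolic plane\<close>

lemma hyp_dist_imaginary_axis:
  assumes "u > 0" "b > 0"
  shows "hyp_dist (Complex 0 u) (Complex a b) = arcosh ((a\<^sup>2 + b\<^sup>2 + u\<^sup>2) / (2 * b * u))"
proof -
  have "1 + (cmod (Complex 0 u - Complex a b))\<^sup>2 / (2 * u * b) = (a\<^sup>2 + b\<^sup>2 + u\<^sup>2) / (2 * b * u)"
    using assms unfolding cmod_power2 by (simp add: field_simps power2_eq_square)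
  then show ?thesis
    by (simp add: hyp_dist_def)
qed

lemma hyp_dist_vertical: "hyp_dist (Complex 0 (exp s)) (Complex 0 (exp t)) = \<bar>s - t\<bar>"
proof -
  have "(0\<^sup>2 + (exp t)\<^sup>2 + (exp s)\<^sup>2) / (2 * exp t * exp s) = cosh (s - t)"
    by (simp add: cosh_def field_simps power2_eq_square exp_diff exp_minus)
  then have "hyp_dist (Complex 0 (exp s)) (Complex 0 (exp t)) = arcosh (cosh \<bar>s - t\<bar>)"
    using hyp_dist_imaginary_axis[of "exp s" "exp t" 0] by simp
  then show ?thesis
    using arcosh_cosh_real[of "\<bar>s - t\<bar>"] by simp
qed

lemma hyp_dist_self: "hyp_dist z z = 0"
  by (simp add: hyp_dist_def)

text \<open>Existence of comparison triangles: by the distance formula the two equations put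
  \<open>a + b i\<close> at distances \<open>B\<close> and \<open>C\<close> from \<open>i\<close>
  and \<open>i * exp A\<close>. Their difference is linear in \<open>b\<close> and determines it. A
  real \<open>a\<close> exists exactly when \<open>exp (-B) \<le> b \<le> exp B\<close>, because
  \<open>2 * b * cosh B - 1 - b\<^sup>2\<close> factors as
  \<open>(exp B - b) * (b - exp (-B))\<close>. One triangle inequality makes the denominator of
  \<open>b\<close> positive, the other two give these bounds.\<close>

lemma half_plane_triangle:
  fixes A B C :: real
  assumes "A > 0" "B \<ge> 0" "C \<ge> 0" "A \<le> B + C" "B \<le> A + C" "C \<le> A + B"
  obtains a b where "b > 0" "a\<^sup>2 + b\<^sup>2 + 1 = 2 * b * cosh B"
    "a\<^sup>2 + b\<^sup>2 + (exp A)\<^sup>2 = 2 * b * exp A * cosh C"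
proof -
  define N where "N = exp A * cosh C - cosh B"
  have "cosh B \<le> cosh (A + C)"
    using assms cosh_real_nonneg_le_iff[of B "A + C"] by auto
  also have "\<dots> < exp A * cosh C"
  proof -
    have "sinh A * sinh C < sinh A * cosh C"
      using assms(1) sinh_less_cosh_real[of C] by simp
    then show ?thesis
      using cosh_plus_sinh[of A] by (simp add: cosh_add flip: cosh_plus_sinh[of A]) (simp add: algebra_simps)
  qed
  finally have N: "N > 0" by (simp add: N_def)
  define b where "b = ((exp A)\<^sup>2 - 1) / (2 * N)"
  have "(exp A)\<^sup>2 > 1"
    using assms(1) by (simp add: one_less_power)
  then have b: "b > 0"
    using N by (simp add: b_def)
  have bN: "2 * b * N = (exp A)\<^sup>2 - 1"
    using N by (simp add: b_def)
  have "cosh (A - B) \<le> cosh C"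
    using assms cosh_real_nonneg_le_iff[of "\<bar>A - B\<bar>" C] by auto
  then have "2 * exp A * exp B * cosh (A - B) \<le> 2 * exp A * exp B * cosh C"
    by simp
  moreover have "2 * exp A * exp B * cosh (A - B) = (exp A)\<^sup>2 + (exp B)\<^sup>2"
    by (simp add: cosh_def exp_diff field_simps power2_eq_square exp_minus)
  ultimately have le1: "(exp A)\<^sup>2 + (exp B)\<^sup>2 \<le> 2 * exp A * exp B * cosh C" by simp
  have coshB: "2 * cosh B = exp B + exp (-B)"
    by (simp add: cosh_def)
  have eB: "exp B * exp (-B) = 1"
    by (simp flip: exp_add)
  have "2 * b * N \<le> 2 * exp B * N"
  proof -
    have "2 * exp B * N = 2 * exp A * exp B * cosh C - exp B * (exp B + exp (-B))"
      by (simp add: N_def algebra_simps flip: coshB)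
    also have "\<dots> = 2 * exp A * exp B * cosh C - (exp B)\<^sup>2 - 1"
      using eB by (simp add: algebra_simps power2_eq_square)
    finally show ?thesis
      using le1 bN by simp
  qed
  then have b1: "b \<le> exp B" using N by simp
  have "cosh C \<le> cosh (A + B)"
    using assms cosh_real_nonneg_le_iff[of C "A + B"] by auto
  then have "2 * exp A * exp (-B) * cosh C \<le> 2 * exp A * exp (-B) * cosh (A + B)"
    by simp
  moreover have "2 * exp A * exp (-B) * cosh (A + B) = (exp A)\<^sup>2 + (exp (-B))\<^sup>2"
    by (simp add: cosh_def exp_add exp_diff field_simps power2_eq_square exp_minus)
  ultimately have le2: "2 * exp A * exp (-B) * cosh C \<le> (exp A)\<^sup>2 + (exp (-B))\<^sup>2" by simp
  have "2 * exp (-B) * N \<le> 2 * b * N"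
  proof -
    have "2 * exp (-B) * N = 2 * exp A * exp (-B) * cosh C - exp (-B) * (exp B + exp (-B))"
      by (simp add: N_def algebra_simps flip: coshB)
    also have "\<dots> = 2 * exp A * exp (-B) * cosh C - (exp (-B))\<^sup>2 - 1"
      using eB by (simp add: algebra_simps power2_eq_square)
    finally show ?thesis
      using le2 bN by simp
  qed
  then have b2: "exp (-B) \<le> b" using N by simp
  have "(exp B - b) * (b - exp (-B)) \<ge> 0"
    using b1 b2 by simp
  then have "2 * b * cosh B - 1 - b\<^sup>2 \<ge> 0"
    using eB coshB by (simp add: algebra_simps power2_eq_square)
  then obtain a where a: "a\<^sup>2 = 2 * b * cosh B - 1 - b\<^sup>2"
    by (metis real_sqrt_pow2)
  have "a\<^sup>2 + b\<^sup>2 + (exp A)\<^sup>2 = 2 * b * exp A * cosh C"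
    using a bN by (simp add: N_def algebra_simps)
  then show ?thesis
    using that[of b a] a b by auto
qed

text \<open>Stewart's theorem in the hyperbolic plane is an equality; \<open>CAT(-1)\<close> turns it into an inequality.\<close>

lemma cat_stewart:
  fixes z :: "'a::metric_space"
  assumes "geodesic_space TYPE('a)" "cat_minus_one TYPE('a)"
    and a: "geodesic_segment a x y" and s: "0 \<le> s" "s \<le> dist x y"
  shows "cosh (dist (a s) z) * sinh (dist x y)
    \<le> cosh (dist x z) * sinh (dist x y - s) + cosh (dist y z) * sinh s"
proof (cases "dist x y = 0")
  case True
  then show ?thesis using s by simp
next
  case False
  define A where "A = dist x y"
  obtain b where b: "geodesic_segment b x z"
    using assms(1) unfolding geodesic_space_def by blast
  obtain \<alpha> \<beta> where \<beta>: "\<beta> > 0" and e1: "\<alpha>\<^sup>2 + \<beta>\<^sup>2 + 1 = 2 * \<beta> * cosh (dist x z)"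
    and e2: "\<alpha>\<^sup>2 + \<beta>\<^sup>2 + (exp A)\<^sup>2 = 2 * \<beta> * exp A * cosh (dist y z)"
  proof (rule half_plane_triangle[of A "dist x z" "dist y z"])
    show "A > 0" using False by (simp add: A_def)
    show "A \<le> dist x z + dist y z" "dist x z \<le> A + dist y z" "dist y z \<le> A + dist x z"
      unfolding A_def by (metis dist_commute dist_triangle)+
  qed auto
  let ?z = "Complex \<alpha> \<beta>"
  have xz: "hyp_dist (Complex 0 1) ?z = dist x z"
    using hyp_dist_imaginary_axis[of 1 \<beta> \<alpha>] \<beta> e1 by (simp add: arcosh_cosh_real)
  have yz: "hyp_dist (Complex 0 (exp A)) ?z = dist y z"
    using hyp_dist_imaginary_axis[of "exp A" \<beta> \<alpha>] \<beta> e2 by (simp add: arcosh_cosh_real)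
  have tri: "comparison_triangle x y z (Complex 0 1) (Complex 0 (exp A)) ?z"
    using xz yz \<beta> hyp_dist_vertical[of 0 A]
    by (simp add: comparison_triangle_def hyp_plane_def A_def)
  have "dist x (a s) = s" "dist (a s) y = A - s"
    using a s unfolding geodesic_segment_def A_def
    by (smt (verit, best) atLeastAtMost_iff)+
  then have cp: "comparison_point x y (Complex 0 1) (Complex 0 (exp A)) (a s) (Complex 0 (exp s))"
    using hyp_dist_vertical[of 0 s] hyp_dist_vertical[of s A] s
    by (simp add: comparison_point_def hyp_plane_def A_def)
  have bz: "b (dist x z) = z"
    using b by (simp add: geodesic_segment_def)
  \<comment> \<open>The CAT condition compares points on two sides from \<open>x\<close>; the far
    end of \<open>b\<close> makes the second of them the vertex \<open>z\<close> itself.\<close>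
  have cq: "comparison_point x z (Complex 0 1) ?z (b (dist x z)) ?z"
    using xz \<beta> by (simp add: bz comparison_point_def hyp_plane_def hyp_dist_self)
  \<comment> \<open>\<open>V\<close> is the hyperbolic cosine of the distance between the two
    comparison points.\<close>
  define V where "V = (\<alpha>\<^sup>2 + \<beta>\<^sup>2 + (exp s)\<^sup>2) / (2 * \<beta> * exp s)"
  have "s \<in> {0..dist x y}" "dist x z \<in> {0..dist x z}"
    using s by auto
  then have "dist (a s) (b (dist x z)) \<le> hyp_dist (Complex 0 (exp s)) ?z"
    using assms(2) a b tri cp cq unfolding cat_minus_one_def by blast
  then have le: "dist (a s) z \<le> arcosh V"
    using hyp_dist_imaginary_axis[of "exp s" \<beta> \<alpha>] \<beta> by (simp add: bz V_def)
  have "(\<beta> - exp s)\<^sup>2 + \<alpha>\<^sup>2 \<ge> 0" by simp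
  then have "V \<ge> 1"
    using \<beta> by (simp add: V_def field_simps power2_eq_square)
  then have "cosh (dist (a s) z) \<le> V"
    using le cosh_real_nonneg_le_iff[of "dist (a s) z" "arcosh V"] by (simp add: cosh_arcosh_real)
  moreover have "sinh (dist x y) \<ge> 0" by simp
  ultimately have "cosh (dist (a s) z) * sinh A \<le> V * sinh A"
    unfolding A_def by (rule mult_right_mono)
  also have "V * sinh A = cosh (dist x z) * sinh (A - s) + cosh (dist y z) * sinh s"
  proof -
    have c1: "cosh (dist x z) = (\<alpha>\<^sup>2 + \<beta>\<^sup>2 + 1) / (2 * \<beta>)"
      using e1 \<beta> by (simp add: field_simps)
    have c2: "cosh (dist y z) = (\<alpha>\<^sup>2 + \<beta>\<^sup>2 + (exp A)\<^sup>2) / (2 * \<beta> * exp A)"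
      using e2 \<beta> by (simp add: field_simps)
    show ?thesis
      unfolding c1 c2 V_def using \<beta>
      by (simp add: sinh_def exp_diff exp_minus divide_simps) (simp add: algebra_simps power2_eq_square)
  qed
  finally show ?thesis by (simp add: A_def)
qed

section \<open>Gromov products and thin triangles\<close>

lemma geodesic_segment_dist:
  assumes "geodesic_segment a x y" "0 \<le> s" "s \<le> dist x y"
  shows "dist x (a s) = s" "dist (a s) y = dist x y - s"
  using assms unfolding geodesic_segment_def by (smt (verit, best) atLeastAtMost_iff)+

lemma geodesic_segment_initial:
  assumes "geodesic_segment a x y" "0 \<le> s" "s \<le> dist x y"
  shows "geodesic_segment a x (a s)"
  using assms geodesic_segment_dist[OF assms] unfolding geodesic_segment_def by auto

lemma geodesic_segment_reverse:
  assumes "geodesic_segment a x y"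
  shows "geodesic_segment (\<lambda>t. a (dist x y - t)) y x"
  using assms unfolding geodesic_segment_def by (auto simp: dist_commute)

lemma geodesic_line_segment:
  assumes "geodesic_line c" "u \<le> v"
  shows "geodesic_segment (\<lambda>t. c (u + t)) (c u) (c v)"
  using assms unfolding geodesic_segment_def geodesic_line_def by auto

lemma geodesically_convexD:
  assumes "geodesically_convex C" "x \<in> C" "y \<in> C" "geodesic_segment a x y" "0 \<le> s" "s \<le> dist x y"
  shows "a s \<in> C"
  using assms unfolding geodesically_convex_def by (metis atLeastAtMost_iff image_subset_iff)

text \<open>The base point is the first argument. On a side from \<open>x\<close> to
  \<open>y\<close>, the parameter \<open>gromov x y z\<close> marks, up to a constant, the point
  nearest to \<open>z\<close>, and \<open>gromov z x y\<close> is its distance to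
  \<open>z\<close>.\<close>

definition gromov :: "'a::metric_space \<Rightarrow> 'a \<Rightarrow> 'a \<Rightarrow> real" where
  "gromov z x y = (dist z x + dist z y - dist x y) / 2"

lemma gromov_commute: "gromov z x y = gromov z y x"
  by (simp add: gromov_def dist_commute)

lemma gromov_nonneg: "0 \<le> gromov z x y"
  using dist_triangle[of x y z] by (simp add: gromov_def dist_commute)

lemma gromov_le_dist: "gromov z x y \<le> dist z x"
  using dist_triangle[of z y x] by (simp add: gromov_def dist_commute)

lemma gromov_change_point: "gromov z x y \<le> gromov z x' y + dist x x'"
  using dist_triangle[of z x x'] dist_triangle[of x' y x] by (simp add: gromov_def dist_commute field_simps)

lemma gromov_change_base: "gromov z x y \<le> gromov z' x y + dist z z'"
  using dist_triangle[of z x z'] dist_triangle[of z y z'] by (simp add: gromov_def field_simps)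

lemma sinh_ratio_le:
  fixes s S :: real
  assumes "0 \<le> s" "s \<le> S"
  shows "sinh s \<le> exp (s - S) * sinh S"
proof -
  have "exp (s - S) * sinh S = (exp s - exp (s - S - S)) / 2"
    by (simp add: sinh_field_def algebra_simps flip: exp_add)
  moreover have "exp (s - S - S) \<le> exp (- s)"
    using assms by simp
  ultimately show ?thesis
    by (simp add: sinh_field_def)
qed

section \<open>Thin triangles, the four point inequality and contraction in \<open>CAT(-1)\<close>
  spaces\<close>

locale cat_space =
  fixes X :: "'a::heine_borel itself"
  assumes geodesic: "geodesic_space TYPE('a)" and cat: "cat_minus_one TYPE('a)"
begin

lemma segment_exists: obtains a where "geodesic_segment a (x::'a) y"
  using geodesic unfolding geodesic_space_def by blast

lemmas stewart = cat_stewart[OF geodesic cat]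

text \<open>Stewart's inequality with \<open>cosh\<close> and \<open>sinh\<close> replaced by
  exponentials. The factor lost is 8, which is at most \<open>exp 3\<close>; this is the source of
  the additive constant 3 everywhere below. Sides of length at most 1 are treated directly, because
  \<open>sinh A\<close> is comparable to \<open>exp A\<close> only when \<open>A\<close> is bounded
  away from 0.\<close>

lemma thin:
  fixes x y z :: 'a
  assumes a: "geodesic_segment a x y" and s: "0 \<le> s" "s \<le> dist x y"
  shows "dist (a s) z \<le> max (dist x z - s) (dist y z - (dist x y - s)) + 3"
proof (cases "dist x y \<le> 1")
  case True
  have "dist (a s) z \<le> dist x z + s"
    using geodesic_segment_dist[OF a s] dist_triangle[of "a s" z x] by (simp add: dist_commute)
  with True s show ?thesis by simp
next
  case False
  define A where "A = dist x y"
  define M where "M = max (dist x z - s) (dist y z - (A - s))"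
  have "exp (2 * A) \<ge> 2"
    using exp_ge_add_one_self[of "2 * A"] False unfolding A_def by linarith
  then have "2 * exp (- A) \<le> exp (2 * A) * exp (- A)"
    by (intro mult_right_mono) auto
  also have "exp (2 * A) * exp (- A) = exp A"
    using exp_add[of "2 * A" "- A"] by simp
  finally have "exp (- A) \<le> exp A / 2"
    by simp
  then have sinhA: "exp A / 4 \<le> sinh A"
    by (simp add: sinh_field_def)
  have sinh_le: "sinh u \<le> exp u / 2" for u :: real
    by (simp add: sinh_field_def)
  have cosh_le: "cosh u \<le> exp u" if "u \<ge> 0" for u :: real
    using that by (simp add: cosh_field_def)
  have "exp (dist (a s) z) / 2 * (exp A / 4) \<le> cosh (dist (a s) z) * sinh A"
    using sinhA by (intro mult_mono) (auto simp: cosh_field_def)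
  also have "\<dots> \<le> cosh (dist x z) * sinh (A - s) + cosh (dist y z) * sinh s"
    unfolding A_def by (rule stewart[OF a s])
  also have "\<dots> \<le> exp (dist x z) * (exp (A - s) / 2) + exp (dist y z) * (exp s / 2)"
    using s by (intro add_mono mult_mono cosh_le sinh_le) (auto simp: A_def)
  also have "\<dots> = exp A / 2 * (exp (dist x z - s) + exp (dist y z - (A - s)))"
    by (simp add: exp_diff exp_add field_simps)
  also have "\<dots> \<le> exp A / 2 * (exp M + exp M)"
    by (intro mult_left_mono add_mono) (auto simp: M_def)
  finally have "exp (dist (a s) z) * exp A \<le> 8 * exp M * exp A"
    by simp
  then have "exp (dist (a s) z) \<le> 8 * exp M"
    by simp
  also have "\<dots> \<le> exp 3 * exp M"
  proof -
    have "(8::real) = 2 ^ 3" by simp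
    also have "\<dots> \<le> exp 1 ^ 3"
      using exp_ge_add_one_self[of "1::real"] by (intro power_mono) auto
    finally show ?thesis
      by (simp flip: exp_of_nat_mult)
  qed
  finally have "exp (dist (a s) z) \<le> exp (M + 3)"
    by (simp add: exp_add mult.commute)
  then show ?thesis
    by (simp add: M_def A_def)
qed

text \<open>At this parameter the two terms of the maximum in \<open>thin\<close> coincide.\<close>

lemma near_segment:
  fixes x y z :: 'a
  assumes a: "geodesic_segment a x y"
  shows "dist (a (gromov x y z)) z \<le> gromov z x y + 3"
proof -
  have "dist x z - gromov x y z = gromov z x y"
    "dist y z - (dist x y - gromov x y z) = gromov z x y"
    by (simp_all add: gromov_def dist_commute field_simps)
  then show ?thesis
    using thin[OF a gromov_nonneg[of x y z] gromov_le_dist[of x y z], of z] by simp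
qed

text \<open>Passing from \<open>r\<close> to \<open>s\<close> through the point of the segment from
  \<open>p\<close> to \<open>q\<close> that is balanced for \<open>r\<close>:
  \<open>near_segment\<close> bounds the first leg, \<open>thin\<close> the second.\<close>

lemma four_point:
  fixes p q r s :: 'a
  shows "dist p q + dist r s \<le> max (dist p r + dist q s) (dist p s + dist q r) + 6"
proof -
  obtain a where a: "geodesic_segment a p q"
    by (rule segment_exists)
  let ?t = "gromov p q r"
  have "dist (a ?t) r \<le> gromov r p q + 3"
    by (rule near_segment[OF a])
  moreover have "dist (a ?t) s \<le> max (dist p s - ?t) (dist q s - (dist p q - ?t)) + 3"
    by (rule thin[OF a gromov_nonneg gromov_le_dist])
  moreover have "dist r s \<le> dist (a ?t) r + dist (a ?t) s"
    by (metis dist_commute dist_triangle)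
  ultimately have "dist r s \<le> gromov r p q + max (dist p s - ?t) (dist q s - (dist p q - ?t)) + 6"
    by linarith
  moreover have "gromov r p q - ?t = dist q r - dist p q"
    "gromov r p q - (dist p q - ?t) = dist p r - dist p q"
    by (simp_all add: gromov_def dist_commute field_simps)
  ultimately show ?thesis
    by linarith
qed

lemma gromov_hyperbolic:
  fixes x y z w :: 'a
  shows "min (gromov w x y) (gromov w y z) \<le> gromov w x z + 3"
proof -
  have "dist w y + dist x z \<le> max (dist w x + dist y z) (dist w z + dist x y) + 6"
    using four_point[of w y x z] by (simp add: dist_commute)
  then show ?thesis
    unfolding gromov_def min_le_iff_disj max_def by (auto simp: field_simps split: if_splits)
qed

text \<open>Geodesics from a common origin converge exponentially when followed backwards; the
  additive bound of \<open>thin\<close> would be too weak for this. Stewart's inequality, used once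
  on each geodesic, gives
  \<open>(f - 1) * (sinh S)\<^sup>2 \<le> (F - 1) * (sinh s)\<^sup>2\<close>, and half-argument
  formulas turn it into a ratio of \<open>sinh s\<close> to \<open>sinh S\<close>.\<close>

lemma fellow_travel:
  fixes y x1 x2 :: 'a
  assumes a: "geodesic_segment a y x1" and b: "geodesic_segment b y x2"
    and s: "0 \<le> s" "s \<le> S" and S: "0 < S" "S \<le> dist y x1" "S \<le> dist y x2"
  shows "dist (a s) (b s) \<le> 2 * sinh (dist (a S) (b S) / 2) * exp (s - S)"
proof -
  have a': "geodesic_segment a y (a S)" and b': "geodesic_segment b y (b S)"
    using geodesic_segment_initial[OF a, of S] geodesic_segment_initial[OF b, of S] S by simp_all
  have dS: "dist y (a S) = S" "dist y (b S) = S" and ds: "dist y (a s) = s" "dist y (b s) = s"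
    using geodesic_segment_dist(1)[OF a, of S] geodesic_segment_dist(1)[OF b, of S]
      geodesic_segment_dist(1)[OF a, of s] geodesic_segment_dist(1)[OF b, of s] S s by simp_all
  define F where "F = cosh (dist (a S) (b S))"
  define G where "G = cosh (dist (a s) (b S))"
  define f where "f = cosh (dist (a s) (b s))"
  have 1: "G * sinh S \<le> cosh S * sinh (S - s) + F * sinh s"
    using stewart[OF a' s(1), of "b S"] s dS by (simp add: F_def G_def)
  have 2: "f * sinh S \<le> cosh s * sinh (S - s) + G * sinh s"
    using stewart[OF b' s(1), of "a s"] s ds dS by (simp add: f_def G_def dist_commute)
  have "f * sinh S * sinh S \<le> (cosh s * sinh (S - s) + G * sinh s) * sinh S"
    using 2 S by (intro mult_right_mono) auto
  also have "\<dots> = cosh s * sinh (S - s) * sinh S + (G * sinh S) * sinh s"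
    by (simp add: algebra_simps)
  also have "\<dots> \<le> cosh s * sinh (S - s) * sinh S + (cosh S * sinh (S - s) + F * sinh s) * sinh s"
    using 1 s by (intro add_left_mono mult_right_mono) auto
  also have "\<dots> = (sinh S)\<^sup>2 + (F - 1) * (sinh s)\<^sup>2"
  proof -
    have "cosh s * sinh (S - s) * sinh S + cosh S * sinh (S - s) * sinh s
        = (sinh S)\<^sup>2 * (cosh s)\<^sup>2 - (cosh S)\<^sup>2 * (sinh s)\<^sup>2"
      by (simp add: sinh_diff algebra_simps power2_eq_square)
    also have "\<dots> = (sinh S)\<^sup>2 - (sinh s)\<^sup>2"
      by (simp add: cosh_square_eq algebra_simps)
    finally show ?thesis by (simp add: algebra_simps power2_eq_square)
  qed
  finally have "(f - 1) * (sinh S)\<^sup>2 \<le> (F - 1) * (sinh s)\<^sup>2"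
    by (simp add: algebra_simps power2_eq_square)
  moreover have "cosh u - 1 = 2 * (sinh (u / 2))\<^sup>2" for u :: real
    using cosh_double[of "u / 2"] by (simp add: cosh_square_eq)
  ultimately have "(sinh (dist (a s) (b s) / 2) * sinh S)\<^sup>2 \<le> (sinh (dist (a S) (b S) / 2) * sinh s)\<^sup>2"
    by (simp add: f_def F_def power_mult_distrib)
  then have "sinh (dist (a s) (b s) / 2) * sinh S \<le> sinh (dist (a S) (b S) / 2) * sinh s"
    by (rule power2_le_imp_le) (use s in simp)
  also have "\<dots> \<le> sinh (dist (a S) (b S) / 2) * (exp (s - S) * sinh S)"
    using sinh_ratio_le[OF s] by (intro mult_left_mono) auto
  finally have "sinh (dist (a s) (b s) / 2) \<le> sinh (dist (a S) (b S) / 2) * exp (s - S)"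
    using S by simp
  moreover have "dist (a s) (b s) / 2 \<le> sinh (dist (a s) (b s) / 2)"
    using real_le_x_sinh[of "dist (a s) (b s) / 2"] by (simp add: sinh_field_def exp_minus)
  ultimately show ?thesis by simp
qed

end

section \<open>Rays, lines and convex sets\<close>

lemma gromov_on_ray:
  assumes "geodesic_ray c" "0 \<le> t" "t \<le> s"
  shows "gromov (c 0) (c s) (c t) = t"
  using assms unfolding geodesic_ray_def gromov_def by auto

lemma geodesic_line_imp_ray:
  assumes "geodesic_line c"
  shows "geodesic_ray c" "geodesic_ray (\<lambda>t. c (- t))"
  using assms unfolding geodesic_line_def geodesic_ray_def by auto

text \<open>Tychonoff's theorem for a product of compact balls. For an uncountable index set a
  cluster point of the sequence stands in for the limit of a subsequence. Approximation at two
  indices at once is what passing distance identities to the limit requires.\<close>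

lemma pointwise_cluster_point:
  fixes f :: "nat \<Rightarrow> 'b \<Rightarrow> 'a::heine_borel"
  assumes "\<And>n t. f n t \<in> cball x (r t)"
  obtains c where "\<And>s t \<epsilon> N. \<epsilon> > 0 \<Longrightarrow> \<exists>n\<ge>N. dist (f n s) (c s) < \<epsilon> \<and> dist (f n t) (c t) < \<epsilon>"
proof -
  have "compactin (product_topology (\<lambda>_. euclidean) UNIV) (PiE UNIV (\<lambda>t. cball x (r t)))"
    by (subst compactin_PiE) (auto simp: compactin_euclidean_iff)
  then have "compact (PiE UNIV (\<lambda>t. cball x (r t)))"
    by (simp add: euclidean_product_topology compactin_euclidean_iff)
  moreover have "filtermap f sequentially \<le> principal (PiE UNIV (\<lambda>t. cball x (r t)))"
    using assms by (auto simp: le_principal eventually_filtermap PiE_def)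
  moreover have "filtermap f sequentially \<noteq> bot"
    by (simp add: filtermap_bot_iff)
  ultimately obtain c where c: "inf (nhds c) (filtermap f sequentially) \<noteq> bot"
    unfolding compact_filter le_principal by blast
  show ?thesis
  proof (rule that[of c])
    fix s t and \<epsilon> :: real and N :: nat
    assume "\<epsilon> > 0"
    let ?U = "{g. dist (g s) (c s) < \<epsilon> \<and> dist (g t) (c t) < \<epsilon>}"
    have "open ?U"
      by (intro open_Collect_conj open_Collect_less continuous_intros continuous_on_product_coordinates)
    then have U: "eventually (\<lambda>g. g \<in> ?U) (nhds c)"
      using \<open>\<epsilon> > 0\<close> by (intro eventually_nhds_in_open) auto
    show "\<exists>n\<ge>N. dist (f n s) (c s) < \<epsilon> \<and> dist (f n t) (c t) < \<epsilon>"
    proof (rule ccontr)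
      assume "\<not> ?thesis"
      then have "eventually (\<lambda>g. g \<notin> ?U) (filtermap f sequentially)"
        unfolding eventually_filtermap eventually_sequentially by blast
      with U have "eventually (\<lambda>_. False) (inf (nhds c) (filtermap f sequentially))"
        unfolding eventually_inf by blast
      with c show False
        by (simp add: trivial_limit_def)
    qed
  qed
qed

section \<open>Lines and rays relative to a closed convex set, and lines between rays\<close>

context cat_space
begin

text \<open>The points \<open>c (- T)\<close> and \<open>c T\<close> are within \<open>R\<close> of
  points \<open>p\<close> and \<open>q\<close> of \<open>C\<close>. The segment from
  \<open>q\<close> to \<open>p\<close> lies in \<open>C\<close> and, by contraction, passes within
  \<open>K * exp (- T)\<close> of \<open>c 0\<close>. Letting \<open>T\<close> grow puts
  \<open>c 0\<close> in the closure of \<open>C\<close>.\<close>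

lemma line_midpoint_in_convex:
  fixes c :: "real \<Rightarrow> 'a"
  assumes C: "closed C" "geodesically_convex C" and c: "geodesic_line c"
    and plus: "\<And>t. t \<ge> 0 \<Longrightarrow> \<exists>p\<in>C. dist (c t) p \<le> R"
    and minus: "\<And>t. t \<ge> 0 \<Longrightarrow> \<exists>p\<in>C. dist (c (- t)) p \<le> R"
  shows "c 0 \<in> C"
proof -
  have R: "R \<ge> 0"
    using plus[of 0] by (meson dist_not_less_zero not_less order_trans order_refl)
  \<comment> \<open>One summand for each of the two comparisons below: the line with the segment
    from \<open>y\<close> to \<open>q\<close>, then that segment with the one from \<open>q\<close>
    to \<open>p\<close>.\<close>
  define K where "K = 2 * sinh (2 * R) * exp R + 2 * sinh (4 * R) * exp (3 * R)"
  have K: "K \<ge> 0"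
    using R by (simp add: K_def)
  have approx: "\<exists>m\<in>C. dist (c 0) m \<le> K * exp (- T)" if T: "T > 4 * R + 1" for T
  proof -
    define y where "y = c (- T)"
    define z where "z = c T"
    obtain p q where p: "p \<in> C" "dist y p \<le> R" and q: "q \<in> C" "dist z q \<le> R"
      using plus[of T] minus[of T] T R by (auto simp: y_def z_def)
    have a: "geodesic_segment (\<lambda>t. c (- T + t)) y z"
      unfolding y_def z_def using T R by (intro geodesic_line_segment[OF c]) auto
    have yz: "dist y z = 2 * T"
      using c T R by (simp add: y_def z_def geodesic_line_def)
    obtain b where b: "geodesic_segment b y q"
      by (rule segment_exists)
    obtain e where e: "geodesic_segment e q p"
      by (rule segment_exists)
    define u where "u = dist y q"
    define v where "v = dist q p"
    have u: "2 * T - R \<le> u" "u \<le> 2 * T + R"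
      using yz q dist_triangle[of y z q] dist_triangle[of y q z] by (auto simp: u_def dist_commute)
    have v: "u - R \<le> v" "v \<le> u + R"
      using p dist_triangle[of y q p] dist_triangle[of q p y] by (auto simp: u_def v_def dist_commute)
    \<comment> \<open>Both segments from \<open>y\<close> have length at least
      \<open>2 * T - R\<close>, so both can be followed up to time \<open>S\<close>.\<close>
    define S where "S = 2 * T - R"
    have S: "0 < S" "T \<le> S" "S \<le> dist y z" "S \<le> dist y q"
      using T R u yz by (auto simp: S_def u_def)
    have "dist (c (- T + S)) (b S) \<le> 4 * R"
    proof -
      have "dist (c (- T + S)) z = dist y z - S"
        using geodesic_segment_dist(2)[OF a, of S] S by simp
      moreover have "dist (b S) q = u - S"
        using geodesic_segment_dist(2)[OF b, of S] S by (simp add: u_def)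
      ultimately show ?thesis
        using dist_triangle[of "c (- T + S)" "b S" z] dist_triangle[of z "b S" q] q u yz
        by (simp add: dist_commute S_def)
    qed
    then have "2 * sinh (dist (c (- T + S)) (b S) / 2) * exp (T - S) \<le> 2 * sinh (2 * R) * exp (R + - T)"
      using R by (intro mult_mono) (auto simp: S_def)
    moreover have "dist (c (- T + T)) (b T) \<le> 2 * sinh (dist (c (- T + S)) (b S) / 2) * exp (T - S)"
      using fellow_travel[OF a b, of T S] S T R by simp
    ultimately have d1: "dist (c 0) (b T) \<le> 2 * sinh (2 * R) * exp R * exp (- T)"
      by (simp add: mult.assoc flip: exp_add)
    \<comment> \<open>Reversing \<open>b\<close> gives it the origin \<open>q\<close> in common with
      \<open>e\<close>, as \<open>fellow_travel\<close> requires.\<close>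
    let ?b = "\<lambda>t. b (u - t)"
    have b': "geodesic_segment ?b q y"
      using geodesic_segment_reverse[OF b] by (simp add: u_def)
    define S' where "S' = 2 * T - 2 * R"
    define s' where "s' = u - T"
    have S': "0 < S'" "0 \<le> s'" "s' \<le> S'" "S' \<le> dist q y" "S' \<le> dist q p"
      using T R u v by (auto simp: S'_def s'_def u_def v_def dist_commute)
    have "dist (?b S') (e S') \<le> 8 * R"
    proof -
      have "dist (?b S') y = u - S'"
        using geodesic_segment_dist(2)[OF b', of S'] S' by (simp add: u_def dist_commute)
      moreover have "dist (e S') p = v - S'"
        using geodesic_segment_dist(2)[OF e, of S'] S' by (simp add: v_def)
      ultimately show ?thesis
        using dist_triangle[of "?b S'" "e S'" y] dist_triangle[of y "e S'" p] p u v
        by (simp add: dist_commute S'_def)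
    qed
    then have "2 * sinh (dist (?b S') (e S') / 2) * exp (s' - S') \<le> 2 * sinh (4 * R) * exp (3 * R + - T)"
      using u R S' by (intro mult_mono) (auto simp: S'_def s'_def)
    moreover have "dist (?b s') (e s') \<le> 2 * sinh (dist (?b S') (e S') / 2) * exp (s' - S')"
      using fellow_travel[OF b' e, of s' S'] S' by simp
    ultimately have d2: "dist (b T) (e s') \<le> 2 * sinh (4 * R) * exp (3 * R) * exp (- T)"
      by (simp add: s'_def mult.assoc flip: exp_add)
    have "e s' \<in> C"
      using geodesically_convexD[OF C(2) q(1) p(1) e] S' by simp
    moreover have "dist (c 0) (e s') \<le> K * exp (- T)"
      using d1 d2 dist_triangle[of "c 0" "e s'" "b T"] by (simp add: K_def algebra_simps)
    ultimately show ?thesis by blast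
  qed
  have "c 0 \<in> closure C"
    unfolding closure_approachable
  proof (intro allI impI)
    fix \<epsilon> :: real assume \<epsilon>: "\<epsilon> > 0"
    define T where "T = max (4 * R + 2) (K / \<epsilon>)"
    have "T > 4 * R + 1" by (simp add: T_def)
    then obtain m where m: "m \<in> C" "dist (c 0) m \<le> K * exp (- T)"
      using approx by blast
    have "K / \<epsilon> \<le> T"
      by (simp add: T_def)
    then have "K / \<epsilon> < exp T"
      using exp_ge_add_one_self[of T] by linarith
    then have "K * exp (- T) < \<epsilon>"
      using \<epsilon> by (simp add: exp_minus field_simps)
    with m show "\<exists>y\<in>C. dist y (c 0) < \<epsilon>"
      by (metis dist_commute order_le_less_trans)
  qed
  then show ?thesis
    using C(1) by simp
qed

text \<open>If some \<open>c t\<close> is far from \<open>C\<close>, then \<open>t\<close> itself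
  bounds the products: a larger product would bring \<open>c t\<close> close to the segment from a
  fixed point \<open>p0\<close> of \<open>C\<close> to \<open>p\<close>, and this segment lies in
  \<open>C\<close>.\<close>

lemma ray_escapes_or_close:
  fixes c :: "real \<Rightarrow> 'a"
  assumes C: "geodesically_convex C" "C \<noteq> {}" and c: "geodesic_ray c"
  shows "(\<exists>M. \<forall>p\<in>C. \<forall>s\<ge>0. gromov (c 0) p (c s) \<le> M) \<or> (\<exists>R. \<forall>t\<ge>0. \<exists>p\<in>C. dist (c t) p \<le> R)"
proof (rule disjCI)
  assume "\<not> (\<exists>R. \<forall>t\<ge>0. \<exists>p\<in>C. dist (c t) p \<le> R)"
  obtain p0 where p0: "p0 \<in> C" using C by blast
  define D where "D = dist p0 (c 0) + 6"
  obtain t where t: "t \<ge> 0" and far: "\<And>p. p \<in> C \<Longrightarrow> dist (c t) p > D"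
    using \<open>\<not> (\<exists>R. _ R)\<close> by (metis not_le)
  have "gromov (c 0) p (c s) \<le> t" if p: "p \<in> C" and s: "s \<ge> 0" for p s
  proof (rule ccontr)
    assume "\<not> ?thesis"
    then have g: "gromov (c 0) p (c s) > t" by simp
    moreover have "gromov (c 0) p (c s) \<le> s"
      using gromov_le_dist[of "c 0" "c s" p] c s by (simp add: gromov_commute geodesic_ray_def)
    ultimately have "gromov (c 0) (c s) (c t) = t"
      using gromov_on_ray[OF c] t by simp
    then have "gromov (c 0) p (c t) \<ge> t - 3"
      using gromov_hyperbolic[of "c 0" p "c s" "c t"] g by simp
    moreover have "dist (c 0) (c t) = t"
      using c t by (simp add: geodesic_ray_def)
    ultimately have "gromov (c t) p0 p \<le> dist p0 (c 0) + 3"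
      using dist_triangle[of "c t" p0 "c 0"] dist_triangle[of "c 0" p p0]
      by (simp add: gromov_def dist_commute field_simps)
    moreover obtain a where a: "geodesic_segment a p0 p"
      by (rule segment_exists)
    moreover have "a (gromov p0 p (c t)) \<in> C"
      using geodesically_convexD[OF C(1) p0 p a] gromov_nonneg gromov_le_dist by metis
    ultimately show False
      using near_segment[OF a, of "c t"] far by (fastforce simp: D_def dist_commute)
  qed
  then show "\<exists>M. \<forall>p\<in>C. \<forall>s\<ge>0. gromov (c 0) p (c s) \<le> M" by blast
qed

text \<open>Otherwise both ends stay at bounded distance from \<open>C\<close> by
  \<open>ray_escapes_or_close\<close>, and \<open>line_midpoint_in_convex\<close>, applied to every
  shift of the line, would put the whole line into \<open>C\<close>.\<close>

lemma line_escapes: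
  fixes c :: "real \<Rightarrow> 'a"
  assumes C: "closed C" "geodesically_convex C" "C \<noteq> {}"
    and c: "geodesic_line c" and nsub: "\<not> range c \<subseteq> C"
  shows "\<exists>M. (\<forall>p\<in>C. \<forall>s\<ge>0. gromov (c 0) p (c s) \<le> M) \<or> (\<forall>p\<in>C. \<forall>s\<ge>0. gromov (c 0) p (c (- s)) \<le> M)"
proof (rule ccontr)
  assume neg: "\<not> ?thesis"
  obtain R1 where R1: "\<And>t. t \<ge> 0 \<Longrightarrow> \<exists>p\<in>C. dist (c t) p \<le> R1"
    using ray_escapes_or_close[OF C(2,3) geodesic_line_imp_ray(1)[OF c]] neg by blast
  obtain R2 where R2: "\<And>t. t \<ge> 0 \<Longrightarrow> \<exists>p\<in>C. dist (c (- t)) p \<le> R2"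
  proof -
    have "\<not> (\<exists>M. \<forall>p\<in>C. \<forall>s\<ge>0. gromov (c 0) p (c (- s)) \<le> M)"
      using neg by blast
    then show ?thesis
      using ray_escapes_or_close[OF C(2,3) geodesic_line_imp_ray(2)[OF c]] that
      unfolding minus_zero by blast
  qed
  have "c u \<in> C" for u
  proof -
    define R where "R = max R1 R2 + \<bar>u\<bar>"
    have d: "dist (c s) (c t) = \<bar>s - t\<bar>" for s t
      using c by (simp add: geodesic_line_def)
    have *: "\<exists>p\<in>C. dist (c (u + t)) p \<le> R" for t
    proof (cases "t \<ge> 0")
      case True
      then obtain p where "p \<in> C" "dist (c t) p \<le> R1" using R1 by blast
      moreover have "dist (c (u + t)) p \<le> \<bar>u\<bar> + dist (c t) p"
        using dist_triangle[of "c (u + t)" p "c t"] d[of "u + t" t] by simp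
      ultimately show ?thesis by (intro bexI[of _ p]) (auto simp: R_def)
    next
      case False
      then obtain p where "p \<in> C" "dist (c t) p \<le> R2" using R2[of "- t"] by auto
      moreover have "dist (c (u + t)) p \<le> \<bar>u\<bar> + dist (c t) p"
        using dist_triangle[of "c (u + t)" p "c t"] d[of "u + t" t] by simp
      ultimately show ?thesis by (intro bexI[of _ p]) (auto simp: R_def)
    qed
    have "geodesic_line (\<lambda>t. c (u + t))"
      using c by (simp add: geodesic_line_def)
    then have "c (u + 0) \<in> C"
      by (rule line_midpoint_in_convex[OF C(1,2), where R = R]) (rule *)+
    then show ?thesis by simp
  qed
  with nsub show False by blast
qed

text \<open>The segments from \<open>u n\<close> to \<open>v n\<close> all pass within a bounded
  distance of \<open>o1\<close>, because the products of their ends at \<open>o1\<close> stay below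
  \<open>B\<close>. Parametrised so that they do so at time 0, they have a cluster point, which is a
  line; \<open>thin\<close> keeps it close to the two rays.\<close>

lemma line_between_rays:
  fixes u v :: "real \<Rightarrow> 'a"
  assumes u: "geodesic_ray u" and v: "geodesic_ray v"
    and unb: "\<not> bounded ((\<lambda>t. dist (u t) (v t)) ` {0..})"
  shows "\<exists>c B. geodesic_line c \<and> (\<forall>t\<ge>0. dist (c t) (v t) \<le> B \<and> dist (c (- t)) (u t) \<le> B)"
proof -
  define o1 where "o1 = u 0"
  define D where "D = dist o1 (v 0)"
  have du: "dist (u s) (u t) = \<bar>s - t\<bar>" if "s \<ge> 0" "t \<ge> 0" for s t
    using u that by (simp add: geodesic_ray_def)
  have dv: "dist (v s) (v t) = \<bar>s - t\<bar>" if "s \<ge> 0" "t \<ge> 0" for s t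
    using v that by (simp add: geodesic_ray_def)
  have ou: "dist o1 (u t) = t" if "t \<ge> 0" for t
    using du[of 0 t] that by (simp add: o1_def)
  have ov: "dist o1 (v t) \<le> D + t" "t - D \<le> dist o1 (v t)" if "t \<ge> 0" for t
    using dv[of 0 t] that dist_triangle[of o1 "v t" "v 0"] dist_triangle[of "v 0" "v t" o1]
    by (auto simp: D_def dist_commute)
  \<comment> \<open>A product of at least \<open>B\<close> between \<open>u n\<close> and
    \<open>v n\<close> would force a product of at least \<open>B - D - 6\<close> between
    \<open>u B\<close> and \<open>v B\<close>, hence
    \<open>dist (u B) (v B) \<le> 3 * D + 12\<close>.\<close>
  obtain B where B: "B \<ge> 0" and farB: "dist (u B) (v B) > 3 * D + 12"
  proof -
    have "\<not> (\<forall>t\<ge>0. dist (u t) (v t) \<le> 3 * D + 12)"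
      using unb by (auto simp: bounded_iff image_iff)
    then show ?thesis using that by force
  qed
  have prod: "gromov o1 (u n) (v n) < B" if n: "n \<ge> B" for n
  proof (rule ccontr)
    assume "\<not> ?thesis"
    then have g: "gromov o1 (u n) (v n) \<ge> B" by simp
    have "gromov o1 (u n) (u B) = B"
      using gromov_on_ray[OF u B n] by (simp add: o1_def)
    then have "gromov o1 (u B) (v n) \<ge> B - 3"
      using gromov_hyperbolic[of o1 "u B" "u n" "v n"] g by (simp add: gromov_commute)
    moreover have "gromov o1 (v n) (v B) \<ge> B - D"
      using gromov_on_ray[OF v B n] gromov_change_base[of "v 0" "v n" "v B" o1]
      by (simp add: D_def dist_commute)
    ultimately have "gromov o1 (u B) (v B) \<ge> B - D - 6"
      using gromov_hyperbolic[of o1 "u B" "v n" "v B"] zero_le_dist[of o1 "v 0"]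
      unfolding D_def by linarith
    then show False
      using farB ou[OF B] ov(1)[OF B] by (simp add: gromov_def field_simps)
  qed
  have "\<forall>n::nat. \<exists>a. geodesic_segment a (u (real n)) (v (real n))"
    using segment_exists by metis
  then obtain a where a: "\<And>n::nat. geodesic_segment (a n) (u (real n)) (v (real n))"
    by metis
  define L where "L n = dist (u (real n)) (v (real n))" for n :: nat
  \<comment> \<open>The time at which the \<open>n\<close>-th segment passes near
    \<open>o1\<close>.\<close>
  define \<tau> where "\<tau> n = gromov (u (real n)) (v (real n)) o1" for n :: nat
  \<comment> \<open>The default value \<open>o1\<close> for small \<open>n\<close> and for times
    outside the segment keeps all values at time \<open>t\<close> in one ball around
    \<open>o1\<close>.\<close>
  define f where "f n t = (if real n \<ge> B \<and> 0 \<le> \<tau> n + t \<and> \<tau> n + t \<le> L n then a n (\<tau> n + t) else o1)"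
    for n :: nat and t
  have \<tau>L: "0 \<le> \<tau> n" "\<tau> n \<le> L n" for n
    by (auto simp: \<tau>_def L_def gromov_nonneg gromov_le_dist)
  have \<tau>1: "real n - B \<le> \<tau> n" and \<tau>2: "real n - D - B \<le> L n - \<tau> n" if n: "real n \<ge> B" for n
  proof -
    have "\<tau> n + gromov o1 (u (real n)) (v (real n)) = real n"
      using ou[of "real n"] by (simp add: \<tau>_def gromov_def dist_commute field_simps)
    then show "real n - B \<le> \<tau> n"
      using prod[OF n] by simp
    have "L n - \<tau> n + gromov o1 (u (real n)) (v (real n)) = dist o1 (v (real n))"
      by (simp add: \<tau>_def L_def gromov_def dist_commute field_simps)
    then show "real n - D - B \<le> L n - \<tau> n"
      using prod[OF n] ov(2)[of "real n"] by simp
  qed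
  have f_eq: "f n t = a n (\<tau> n + t)" "0 \<le> \<tau> n + t" "\<tau> n + t \<le> L n"
    if "real n \<ge> B + D + \<bar>t\<bar>" for n t
  proof -
    have D: "D \<ge> 0" by (simp add: D_def)
    then have n: "real n \<ge> B" using that by simp
    show "0 \<le> \<tau> n + t" "\<tau> n + t \<le> L n"
      using \<tau>1[OF n] \<tau>2[OF n] that D by linarith+
    then show "f n t = a n (\<tau> n + t)"
      using n by (simp add: f_def)
  qed
  have adist: "dist (a n s) (a n t) = \<bar>s - t\<bar>" if "0 \<le> s" "s \<le> L n" "0 \<le> t" "t \<le> L n" for n s t
    using a[of n] that by (simp add: geodesic_segment_def L_def)
  have "f n t \<in> cball o1 (B + 3 + \<bar>t\<bar>)" for n t
  proof (cases "real n \<ge> B \<and> 0 \<le> \<tau> n + t \<and> \<tau> n + t \<le> L n")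
    case True
    have "dist (a n (\<tau> n)) o1 \<le> gromov o1 (u (real n)) (v (real n)) + 3"
      unfolding \<tau>_def by (rule near_segment[OF a])
    moreover have "dist (a n (\<tau> n)) (a n (\<tau> n + t)) = \<bar>t\<bar>"
      using True \<tau>L[of n] by (subst adist) auto
    ultimately show ?thesis
      using True prod[of "real n"] dist_triangle[of o1 "a n (\<tau> n + t)" "a n (\<tau> n)"]
      by (simp add: f_def dist_commute)
  next
    case False
    then show ?thesis using B by (auto simp: f_def)
  qed
  then obtain c where c: "\<And>s t \<epsilon> N. \<epsilon> > 0 \<Longrightarrow> \<exists>n\<ge>N. dist (f n s) (c s) < \<epsilon> \<and> dist (f n t) (c t) < \<epsilon>"
    using pointwise_cluster_point[of f o1 "\<lambda>t. B + 3 + \<bar>t\<bar>"] by blast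
  have line: "dist (c s) (c t) = \<bar>s - t\<bar>" for s t
  proof -
    have "\<bar>dist (c s) (c t) - \<bar>s - t\<bar>\<bar> \<le> \<epsilon>" if "\<epsilon> > 0" for \<epsilon>
    proof -
      obtain N :: nat where N: "real N \<ge> B + D + \<bar>s\<bar> + \<bar>t\<bar>"
        using real_arch_simple by blast
      obtain n where n: "n \<ge> N" "dist (f n s) (c s) < \<epsilon> / 2" "dist (f n t) (c t) < \<epsilon> / 2"
        using c[of "\<epsilon> / 2" N s t] \<open>\<epsilon> > 0\<close> by auto
      have "real n \<ge> B + D + \<bar>s\<bar>" "real n \<ge> B + D + \<bar>t\<bar>"
        using n N by linarith+
      then have "dist (f n s) (f n t) = \<bar>s - t\<bar>"
        using f_eq[of s n] f_eq[of t n] adist by simp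
      then show ?thesis
        using n dist_triangle[of "c s" "c t" "f n s"] dist_triangle[of "f n s" "c t" "f n t"]
          dist_triangle[of "f n s" "f n t" "c s"] dist_triangle[of "c s" "f n t" "c t"]
        by (simp add: dist_commute)
    qed
    then show ?thesis
      using field_le_epsilon[of "\<bar>dist (c s) (c t) - \<bar>s - t\<bar>\<bar>" 0] by simp
  qed
  \<comment> \<open>The estimate \<open>2 * D + B + 3\<close> for the approximating segments, plus 1
    for the approximation of \<open>c\<close> by \<open>f n\<close>.\<close>
  define B' where "B' = 2 * D + B + 4"
  have close: "dist (c t) (v t) \<le> B' \<and> dist (c (- t)) (u t) \<le> B'" if t: "t \<ge> 0" for t
  proof -
    obtain N :: nat where N: "real N \<ge> B + D + \<bar>t\<bar>"
      using real_arch_simple by blast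
    obtain n where n: "n \<ge> N" "dist (f n t) (c t) < 1" "dist (f n (- t)) (c (- t)) < 1"
      using c[of 1 N t "- t"] by auto
    have nt: "real n \<ge> B + D + \<bar>t\<bar>" "real n \<ge> B + D + \<bar>- t\<bar>"
      using n N by linarith+
    have D: "D \<ge> 0" by (simp add: D_def)
    have n': "real n \<ge> t" "real n \<ge> B" "real n \<ge> 0"
      using nt B D by linarith+
    note \<tau> = \<tau>1[OF n'(2)] \<tau>2[OF n'(2)]
    have uv: "dist (u (real n)) (v t) \<le> real n + D + t"
      using dist_triangle[of "u (real n)" "v t" o1] ou[OF n'(3)] ov(1)[OF t]
      by (simp add: dist_commute)
    have vu: "dist (v (real n)) (u t) \<le> real n + D + t"
      using dist_triangle[of "v (real n)" "u t" o1] ou[OF t] ov(1)[OF n'(3)]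
      by (simp add: dist_commute)
    have "dist (a n (\<tau> n + t)) (v t) \<le> max (dist (u (real n)) (v t) - (\<tau> n + t))
        (dist (v (real n)) (v t) - (L n - (\<tau> n + t))) + 3"
      using thin[OF a, of "\<tau> n + t" n "v t"] f_eq[OF nt(1)] by (simp add: L_def)
    also have "\<dots> \<le> 2 * D + B + 3"
      using uv dv[OF n'(3) t] n' \<tau> D by simp
    finally have 1: "dist (f n t) (v t) \<le> 2 * D + B + 3"
      using f_eq[OF nt(1)] by simp
    have "dist (a n (\<tau> n + - t)) (u t) \<le> max (dist (u (real n)) (u t) - (\<tau> n + - t))
        (dist (v (real n)) (u t) - (L n - (\<tau> n + - t))) + 3"
      using thin[OF a, of "\<tau> n + - t" n "u t"] f_eq[OF nt(2)] by (simp add: L_def)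
    also have "\<dots> \<le> 2 * D + B + 3"
      using vu du[OF n'(3) t] n' \<tau> D by simp
    finally have 2: "dist (f n (- t)) (u t) \<le> 2 * D + B + 3"
      using f_eq[OF nt(2)] by simp
    show ?thesis
      using 1 2 n dist_triangle[of "c t" "v t" "f n t"] dist_triangle[of "c (- t)" "u t" "f n (- t)"]
      by (simp add: B'_def dist_commute)
  qed
  show ?thesis
    using line close unfolding geodesic_line_def by blast
qed

end

section \<open>Limit sets and their hulls\<close>

lemma asymptotic_iff:
  "(c, c') \<in> asymptotic \<longleftrightarrow>
     geodesic_ray c \<and> geodesic_ray c' \<and> (\<exists>B. \<forall>t\<ge>0. dist (c t) (c' t) \<le> B)"
  by (auto simp: asymptotic_def bounded_iff)

lemma equiv_asymptotic:
  "equiv (Collect geodesic_ray) (asymptotic :: ((real \<Rightarrow> 'a::metric_space) \<times> _) set)"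
  (is "equiv ?A ?R")
proof (rule equivI)
  show "?R \<subseteq> ?A \<times> ?A"
    by (auto simp: asymptotic_iff)
  show "refl_on ?A ?R"
    by (auto simp: refl_on_def asymptotic_iff)
  show "sym ?R"
    by (auto simp: sym_def asymptotic_iff dist_commute)
  show "trans ?R"
  proof (rule transI)
    fix a b c :: "real \<Rightarrow> 'a"
    assume "(a, b) \<in> ?R" "(b, c) \<in> ?R"
    then obtain B B' where B: "geodesic_ray a" "\<forall>t\<ge>0. dist (a t) (b t) \<le> B"
      "geodesic_ray c" "\<forall>t\<ge>0. dist (b t) (c t) \<le> B'"
      unfolding asymptotic_iff by blast
    have "dist (a t) (c t) \<le> B + B'" if "t \<ge> 0" for t
      using B(2,4) that by (metis add_mono dist_triangle order_trans)
    with B show "(a, c) \<in> ?R"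
      unfolding asymptotic_iff by blast
  qed
qed

lemma boundary_cases:
  assumes "\<xi> \<in> boundary_at_infinity"
  obtains u where "geodesic_ray u" "\<xi> = asymptotic `` {u}" "u \<in> \<xi>"
proof -
  obtain u where u: "geodesic_ray u" "\<xi> = asymptotic `` {u}"
    using assms unfolding boundary_at_infinity_def by (auto elim: quotientE)
  then have "u \<in> \<xi>"
    by (auto simp: asymptotic_iff)
  with u that show ?thesis by blast
qed

lemma boundary_ray: "\<xi> \<in> boundary_at_infinity \<Longrightarrow> c \<in> \<xi> \<Longrightarrow> geodesic_ray c"
  by (erule boundary_cases) (auto simp: asymptotic_iff)

lemma closed_convex_limit_hull:
  "closed (limit_hull G)" "geodesically_convex (limit_hull G)"
proof -
  have "closed (limit_hull G) \<and> geodesically_convex (limit_hull G)"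
    unfolding limit_hull_def hull_at_infinity_def
  proof (rule hull_in)
    fix T :: "'a set set"
    assume T: "\<forall>C\<in>T. closed C \<and> geodesically_convex C"
    then show "closed (\<Inter>T) \<and> geodesically_convex (\<Inter>T)"
      unfolding geodesically_convex_def by blast
  qed
  then show "closed (limit_hull G)" "geodesically_convex (limit_hull G)" by auto
qed

lemma limit_hull_least:
  assumes "closed C" "geodesically_convex C"
    and "\<And>c \<xi> \<eta>. \<xi> \<in> limit_set G \<Longrightarrow> \<eta> \<in> limit_set G \<Longrightarrow> line_joins c \<xi> \<eta> \<Longrightarrow> range c \<subseteq> C"
  shows "limit_hull G \<subseteq> C"
  unfolding limit_hull_def hull_at_infinity_def
  by (rule hull_minimal) (use assms in blast)+

lemma line_subset_limit_hull:
  assumes "\<xi> \<in> limit_set G" "\<eta> \<in> limit_set G" "line_joins c \<xi> \<eta>"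
  shows "range c \<subseteq> limit_hull G"
proof -
  have "range c \<subseteq> \<Union>{range c | c. \<exists>\<xi>\<in>limit_set G. \<exists>\<eta>\<in>limit_set G. line_joins c \<xi> \<eta>}"
    using assms by blast
  also have "\<dots> \<subseteq> limit_hull G"
    unfolding limit_hull_def hull_at_infinity_def by (rule hull_subset)
  finally show ?thesis .
qed

text \<open>Turns the cone topology into Gromov products. The neighbourhood with \<epsilon> equal to
  1 costs at most 1 in the product.\<close>

lemma limit_set_approach:
  assumes "\<xi> \<in> limit_set G" "c \<in> \<xi>" "r > 0"
  shows "\<exists>g\<in>G. dist (c 0) (g x) > r \<and> gromov (c 0) (g x) (c r) \<ge> r - 1"
proof -
  have "geodesic_ray c"
    using assms boundary_ray unfolding limit_set_def by blast
  then have r: "dist (c 0) (c r) = r"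
    using assms(3) by (simp add: geodesic_ray_def)
  obtain g where g: "g \<in> G" "g x \<in> cone_nbhd c r 1"
  proof -
    have "\<forall>\<epsilon>>0. \<exists>g\<in>G. g x \<in> cone_nbhd c r \<epsilon>"
      using assms unfolding limit_set_def by blast
    then show ?thesis
      using that zero_less_one by blast
  qed
  then obtain a where far: "dist (c 0) (g x) > r" and a: "geodesic_segment a (c 0) (g x)"
    and "dist (a r) (c r) < 1"
    unfolding cone_nbhd_def by blast
  moreover have "dist (a r) (g x) = dist (c 0) (g x) - r"
    using geodesic_segment_dist(2)[OF a, of r] far assms(3) by simp
  ultimately have "gromov (c 0) (g x) (c r) \<ge> r - 1"
    using dist_triangle[of "g x" "c r" "a r"] r by (simp add: gromov_def dist_commute field_simps)
  with g far show ?thesis by blast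
qed

section \<open>Groups of isometries\<close>

abbreviation isom_inv :: "('a \<Rightarrow> 'a) \<Rightarrow> 'a \<Rightarrow> 'a" where
  "isom_inv g \<equiv> inv_into UNIV g"

text \<open>Group laws in terms of plain composition, so that \<Gamma>,
  \<open>\<Gamma>\<^sub>0\<close> and the stabilizer can be treated alike without the record
  \<open>isometry_group\<close>.\<close>

locale isom_group =
  fixes G :: "('a::metric_space \<Rightarrow> 'a) set"
  assumes id_mem: "id \<in> G"
    and comp_mem: "g \<in> G \<Longrightarrow> h \<in> G \<Longrightarrow> g \<circ> h \<in> G"
    and iso: "g \<in> G \<Longrightarrow> dist (g x) (g y) = dist x y"
    and ex_inverse: "g \<in> G \<Longrightarrow> \<exists>h\<in>G. g \<circ> h = id \<and> h \<circ> g = id"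
begin

lemma isom_inv:
  assumes "g \<in> G"
  shows inv_mem: "isom_inv g \<in> G" and inv_right [simp]: "g (isom_inv g x) = x"
    and inv_left [simp]: "isom_inv g (g x) = x"
proof -
  obtain h where h: "h \<in> G" "g \<circ> h = id" "h \<circ> g = id"
    using ex_inverse[OF assms] by blast
  then have "isom_inv g = h"
    by (metis inv_unique_comp)
  with h show "isom_inv g \<in> G" "g (isom_inv g x) = x" "isom_inv g (g x) = x"
    by (simp_all add: pointfree_idE)
qed

lemma inv_comp: "g \<in> G \<Longrightarrow> isom_inv g \<circ> g = id" "g \<in> G \<Longrightarrow> g \<circ> isom_inv g = id"
  by (auto simp: fun_eq_iff)

lemma dist_inv: "g \<in> G \<Longrightarrow> dist (isom_inv g x) y = dist x (g y)"
  using iso[of g "isom_inv g x" y] by simp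

lemma dist_inv': "g \<in> G \<Longrightarrow> dist x (isom_inv g y) = dist (g x) y"
  by (metis dist_commute dist_inv)

lemma continuous_iso: "g \<in> G \<Longrightarrow> continuous_on S g"
  unfolding continuous_on_iff using iso by auto

lemma geodesic_segment_iso: "g \<in> G \<Longrightarrow> geodesic_segment c x y \<Longrightarrow> geodesic_segment (g \<circ> c) (g x) (g y)"
  by (auto simp: geodesic_segment_def iso)

lemma geodesic_ray_iso: "g \<in> G \<Longrightarrow> geodesic_ray c \<Longrightarrow> geodesic_ray (g \<circ> c)"
  by (auto simp: geodesic_ray_def iso)

lemma geodesic_line_iso: "g \<in> G \<Longrightarrow> geodesic_line c \<Longrightarrow> geodesic_line (g \<circ> c)"
  by (auto simp: geodesic_line_def iso)

lemma boundary_iso: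
  assumes g: "g \<in> G" and \<xi>: "\<xi> \<in> boundary_at_infinity"
  shows "(\<circ>) g ` \<xi> \<in> boundary_at_infinity"
proof -
  obtain u where u: "geodesic_ray u" "\<xi> = asymptotic `` {u}"
    using \<xi> boundary_cases by metis
  have "(\<circ>) g ` \<xi> = asymptotic `` {g \<circ> u}"
  proof (intro equalityI subsetI)
    fix c assume "c \<in> (\<circ>) g ` \<xi>"
    then show "c \<in> asymptotic `` {g \<circ> u}"
      using u g by (auto simp: asymptotic_iff iso geodesic_ray_iso)
  next
    fix c assume c: "c \<in> asymptotic `` {g \<circ> u}"
    then have "isom_inv g \<circ> c \<in> \<xi>"
      using u g geodesic_ray_iso[OF inv_mem[OF g]] by (auto simp: asymptotic_iff dist_inv')
    moreover have "c = g \<circ> (isom_inv g \<circ> c)"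
      using g by (auto simp: fun_eq_iff)
    ultimately show "c \<in> (\<circ>) g ` \<xi>" by blast
  qed
  then show ?thesis
    using u geodesic_ray_iso[OF g] unfolding boundary_at_infinity_def by (auto intro: quotientI)
qed

lemma limit_set_iso:
  assumes g: "g \<in> G" and \<xi>: "\<xi> \<in> limit_set G"
  shows "(\<circ>) g ` \<xi> \<in> limit_set G"
  unfolding limit_set_def
proof (intro CollectI conjI allI ballI impI)
  show "(\<circ>) g ` \<xi> \<in> boundary_at_infinity"
    using assms boundary_iso by (auto simp: limit_set_def)
  fix x c and r \<epsilon> :: real
  assume "c \<in> (\<circ>) g ` \<xi>" "r > 0" "\<epsilon> > 0"
  then obtain c' where c': "c' \<in> \<xi>" "c = g \<circ> c'" by blast
  obtain h where h: "h \<in> G" "h x \<in> cone_nbhd c' r \<epsilon>"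
    using \<xi> c' \<open>r > 0\<close> \<open>\<epsilon> > 0\<close> unfolding limit_set_def by blast
  then obtain a where a: "dist (c' 0) (h x) > r" "geodesic_segment a (c' 0) (h x)" "dist (a r) (c' r) < \<epsilon>"
    unfolding cone_nbhd_def by blast
  then have "(g \<circ> h) x \<in> cone_nbhd c r \<epsilon>"
    unfolding cone_nbhd_def using g c' geodesic_segment_iso[OF g a(2)] by (auto simp: iso)
  then show "\<exists>h\<in>G. h x \<in> cone_nbhd c r \<epsilon>"
    using comp_mem[OF g h(1)] by blast
qed

text \<open>The preimage of the hull under a group element is closed and convex and contains every
  line joining limit points, so minimality of the hull gives one inclusion; the inverse element
  gives the other.\<close>

lemma limit_hull_image:
  assumes g: "g \<in> G"
  shows "g ` limit_hull G = limit_hull G"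
proof -
  have sub: "h ` limit_hull G \<subseteq> limit_hull G" if h: "h \<in> G" for h
  proof -
    have "limit_hull G \<subseteq> h -` limit_hull G"
    proof (rule limit_hull_least)
      show "closed (h -` limit_hull G)"
        using continuous_on_closed_vimage[of UNIV h] continuous_iso[OF h] closed_convex_limit_hull(1)
        by force
      show "geodesically_convex (h -` limit_hull G)"
        unfolding geodesically_convex_def
      proof (intro ballI allI impI)
        fix x y c
        assume "x \<in> h -` limit_hull G" "y \<in> h -` limit_hull G" and c: "geodesic_segment c x y"
        then have "(h \<circ> c) ` {0..dist (h x) (h y)} \<subseteq> limit_hull G"
          using closed_convex_limit_hull(2)[of G] geodesic_segment_iso[OF h c]
          unfolding geodesically_convex_def by blast
        then show "c ` {0..dist x y} \<subseteq> h -` limit_hull G"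
          using h by (auto simp: iso)
      qed
      fix c \<xi> \<eta>
      assume \<xi>: "\<xi> \<in> limit_set G" and \<eta>: "\<eta> \<in> limit_set G" and c: "line_joins c \<xi> \<eta>"
      have "(\<lambda>t. (h \<circ> c) (- t)) = h \<circ> (\<lambda>t. c (- t))" by auto
      then have "line_joins (h \<circ> c) ((\<circ>) h ` \<xi>) ((\<circ>) h ` \<eta>)"
        using c geodesic_line_iso[OF h] unfolding line_joins_def by auto
      then have "range (h \<circ> c) \<subseteq> limit_hull G"
        using line_subset_limit_hull limit_set_iso[OF h] \<xi> \<eta> by blast
      then show "range c \<subseteq> h -` limit_hull G" by auto
    qed
    then show ?thesis by auto
  qed
  have "limit_hull G \<subseteq> g ` limit_hull G"
  proof
    fix x assume "x \<in> limit_hull G"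
    then have "isom_inv g x \<in> limit_hull G"
      using sub[OF inv_mem[OF g]] by auto
    from imageI[OF this, of g] show "x \<in> g ` limit_hull G"
      using g by simp
  qed
  with sub[OF g] show ?thesis by auto
qed

text \<open>The orbits that come closer than \<open>n\<close> to \<open>x\<close> form an open set
  \<open>U n\<close> of the quotient, and these sets cover it; a finite subcover yields
  \<open>R\<close>. The point \<open>x\<close> is arbitrary, so one base point serves both the hull
  and the frontier.\<close>

lemma cocompact_orbit_dense:
  assumes "compact_space (orbit_space G S)"
  obtains R where "\<And>p. p \<in> S \<Longrightarrow> \<exists>g\<in>G. dist (g x) p \<le> R"
proof -
  define U where "U n = {u \<in> orbit_of G ` S. \<exists>q\<in>u. dist q x < real n}" for n :: nat
  have opn: "openin (orbit_space G S) (U n)" for n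
  proof -
    have eq: "{p \<in> S. orbit_of G p \<in> U n} = S \<inter> (\<Union>g\<in>G. {p. dist (g p) x < real n})"
      by (auto simp: U_def orbit_of_def)
    have "open {p. dist (g p) x < real n}" if "g \<in> G" for g
      by (rule open_Collect_less) (intro continuous_on_dist continuous_on_const continuous_iso that)+
    then have "open (\<Union>g\<in>G. {p. dist (g p) x < real n})"
      by blast
    then show ?thesis
      unfolding openin_orbit_space eq by (auto simp: U_def openin_open_Int)
  qed
  have top: "topspace (orbit_space G S) = orbit_of G ` S"
  proof (rule antisym)
    show "topspace (orbit_space G S) \<subseteq> orbit_of G ` S"
      using openin_topspace[of "orbit_space G S"] unfolding openin_orbit_space by blast
    have "openin (orbit_space G S) (orbit_of G ` S)"
    proof -
      have "{p \<in> S. orbit_of G p \<in> orbit_of G ` S} = S" by blast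
      then show ?thesis
        unfolding openin_orbit_space by simp
    qed
    then show "orbit_of G ` S \<subseteq> topspace (orbit_space G S)"
      by (rule openin_subset)
  qed
  have cover: "orbit_of G ` S \<subseteq> \<Union>(range U)"
  proof
    fix u assume u: "u \<in> orbit_of G ` S"
    then obtain p where "p \<in> S" "u = orbit_of G p" by blast
    then have "p \<in> u"
      using imageI[OF id_mem, of "\<lambda>g. g p"] by (simp add: orbit_of_def)
    moreover obtain n where "dist p x < real n"
      using reals_Archimedean2 by blast
    ultimately have "u \<in> U n"
      using u unfolding U_def mem_Collect_eq by blast
    then show "u \<in> \<Union>(range U)" by blast
  qed
  have "compactin (orbit_space G S) (orbit_of G ` S)"
    using assms by (simp add: compact_space_def top)
  then have "\<exists>\<F>. finite \<F> \<and> \<F> \<subseteq> range U \<and> orbit_of G ` S \<subseteq> \<Union>\<F>"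
    by (rule compactinD) (use opn cover in auto)
  then obtain \<F> where \<F>: "finite \<F>" "\<F> \<subseteq> range U" "orbit_of G ` S \<subseteq> \<Union>\<F>"
    by blast
  obtain N where "finite N" "\<F> = U ` N"
    using finite_subset_image[OF \<F>(1,2)] by blast
  with \<F> have N: "finite N" "orbit_of G ` S \<subseteq> (\<Union>n\<in>N. U n)"
    by simp_all
  define R where "R = Max (insert 0 (real ` N))"
  have "\<exists>g\<in>G. dist (g x) p \<le> R" if p: "p \<in> S" for p
  proof -
    obtain n where n: "n \<in> N" "orbit_of G p \<in> U n"
      using N p by blast
    then have "\<exists>q\<in>orbit_of G p. dist q x < real n"
      by (simp add: U_def)
    then obtain g where g: "g \<in> G" "dist (g p) x < real n"
      unfolding orbit_of_def by blast
    have "real n \<le> R"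
      unfolding R_def using N n by (intro Max_ge) auto
    then have "dist (isom_inv g x) p \<le> R"
      using g(2) unfolding dist_inv[OF g(1)] dist_commute[of x] by linarith
    then show ?thesis
      using inv_mem[OF g(1)] by blast
  qed
  then show ?thesis by (rule that)
qed

lemma set_stabilizer_isom_group: "isom_group (set_stabilizer G C)"
proof
  show "id \<in> set_stabilizer G C"
    by (simp add: set_stabilizer_def id_mem)
next
  fix g h assume "g \<in> set_stabilizer G C" "h \<in> set_stabilizer G C"
  then show "g \<circ> h \<in> set_stabilizer G C"
    using comp_mem[of g h] image_comp[of g h C] by (simp add: set_stabilizer_def)
next
  fix g x y assume "g \<in> set_stabilizer G C"
  then show "dist (g x) (g y) = dist x y"
    using iso by (simp add: set_stabilizer_def)
next
  fix g assume g: "g \<in> set_stabilizer G C"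
  then have gG: "g \<in> G" and gC: "g ` C = C"
    by (auto simp: set_stabilizer_def)
  have "isom_inv g ` C = isom_inv g ` g ` C"
    by (simp add: gC)
  also have "\<dots> = C"
    by (simp add: image_comp inv_comp[OF gG])
  finally show "\<exists>h\<in>set_stabilizer G C. g \<circ> h = id \<and> h \<circ> g = id"
    using inv_mem[OF gG] inv_comp[OF gG] by (auto simp: set_stabilizer_def)
qed

end

lemma group_isometry_group: "group (isometry_group :: ('a::metric_space \<Rightarrow> 'a) monoid)"
proof (rule groupI)
  fix f :: "'a \<Rightarrow> 'a" assume f: "f \<in> carrier isometry_group"
  then have "bij f" and iso: "dist (f x) (f y) = dist x y" for x y
    by (simp_all add: isometry_group_def)
  then have "bij (inv_into UNIV f)" "\<And>x. f (inv_into UNIV f x) = x" "inv_into UNIV f \<circ> f = id"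
    by (auto simp: bij_imp_bij_inv bij_is_surj surj_f_inv_f bij_is_inj inv_o_cancel)
  moreover from this have "dist (inv_into UNIV f x) (inv_into UNIV f y) = dist x y" for x y
    using iso[of "inv_into UNIV f x" "inv_into UNIV f y"] by simp
  ultimately show "\<exists>g\<in>carrier isometry_group. g \<otimes>\<^bsub>isometry_group\<^esub> f = \<one>\<^bsub>isometry_group\<^esub>"
    by (intro bexI[of _ "inv_into UNIV f"]) (auto simp: isometry_group_def)
qed (auto simp: isometry_group_def bij_comp o_assoc)

lemma subgroup_isom_group:
  fixes G :: "('a::metric_space \<Rightarrow> 'a) set"
  assumes "subgroup G isometry_group"
  shows "isom_group G"
proof
  interpret I: group "isometry_group :: ('a \<Rightarrow> 'a) monoid"
    by (rule group_isometry_group)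
  show "id \<in> G"
    using subgroup.one_closed[OF assms] by (simp add: isometry_group_def)
  show "g \<circ> h \<in> G" if "g \<in> G" "h \<in> G" for g h
    using subgroup.m_closed[OF assms that] by (simp add: isometry_group_def)
  fix g assume g: "g \<in> G"
  then have gc: "g \<in> carrier isometry_group"
    using subgroup.mem_carrier[OF assms] by blast
  then show "dist (g x) (g y) = dist x y" for x y
    by (simp add: isometry_group_def)
  show "\<exists>h\<in>G. g \<circ> h = id \<and> h \<circ> g = id"
    using subgroup.m_inv_closed[OF assms g] I.r_inv[OF gc] I.l_inv[OF gc]
    by (intro bexI[of _ "m_inv isometry_group g"]) (simp_all add: isometry_group_def)
qed

section \<open>Hulls of limit sets: nonemptiness and directions leaving a convex set\<close>

context cat_space
begin

text \<open>Distinct limit points are represented by rays that diverge, so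
  \<open>line_between_rays\<close> provides a line joining them, and this line lies in the
  hull.\<close>

lemma limit_hull_nonempty:
  fixes G :: "('a \<Rightarrow> 'a) set"
  assumes \<xi>: "\<xi> \<in> limit_set G" and \<eta>: "\<eta> \<in> limit_set G" and "\<xi> \<noteq> \<eta>"
  shows "limit_hull G \<noteq> {}"
proof -
  have bd: "\<xi> \<in> boundary_at_infinity" "\<eta> \<in> boundary_at_infinity"
    using \<xi> \<eta> by (simp_all add: limit_set_def)
  obtain u where u: "geodesic_ray u" "\<xi> = asymptotic `` {u}"
    by (rule boundary_cases[OF bd(1)])
  obtain v where v: "geodesic_ray v" "\<eta> = asymptotic `` {v}"
    by (rule boundary_cases[OF bd(2)])
  have "(u, v) \<notin> asymptotic"
    using equiv_class_eq[OF equiv_asymptotic, of u v] \<open>\<xi> \<noteq> \<eta>\<close> u(2) v(2) by auto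
  then have "\<not> bounded ((\<lambda>t. dist (u t) (v t)) ` {0..})"
    using u v by (simp add: asymptotic_def)
  then obtain c B where c: "geodesic_line c"
    "\<forall>t\<ge>0. dist (c t) (v t) \<le> B \<and> dist (c (- t)) (u t) \<le> B"
    using line_between_rays[OF u(1) v(1)] by blast
  have "\<forall>t\<ge>0. dist (v t) (c t) \<le> B" "\<forall>t\<ge>0. dist (u t) (c (- t)) \<le> B"
    using c by (simp_all add: dist_commute)
  then have "c \<in> \<eta>" "(\<lambda>t. c (- t)) \<in> \<xi>"
    using u v geodesic_line_imp_ray[OF c(1)] unfolding u(2) v(2) Image_singleton_iff asymptotic_iff
    by blast+
  then have "line_joins c \<xi> \<eta>"
    using c(1) by (simp add: line_joins_def)
  then show ?thesis
    using line_subset_limit_hull[OF \<xi> \<eta>] by auto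
qed

text \<open>Some line joining limit points is not contained in \<open>C\<close>, and one of its ends
  has bounded products with \<open>C\<close>. Orbit points approaching that end inherit the
  bound.\<close>

lemma escape_from_convex:
  fixes G :: "('a \<Rightarrow> 'a) set" and x :: 'a
  assumes C: "closed C" "geodesically_convex C" "C \<noteq> {}" and "\<not> limit_hull G \<subseteq> C"
  obtains m where "\<And>L. \<exists>g\<in>G. dist x (g x) > L \<and> (\<forall>p\<in>C. gromov x p (g x) \<le> m)"
proof -
  obtain c \<xi> \<eta> where \<xi>: "\<xi> \<in> limit_set G" and \<eta>: "\<eta> \<in> limit_set G"
    and c: "line_joins c \<xi> \<eta>" "\<not> range c \<subseteq> C"
  proof (rule ccontr)
    assume "\<not> thesis"
    then have "limit_hull G \<subseteq> C"
      using that by (intro limit_hull_least[OF C(1,2)]) blast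
    with assms(4) show False ..
  qed
  have line: "geodesic_line c"
    using c by (simp add: line_joins_def)
  obtain \<zeta> e M where \<zeta>: "\<zeta> \<in> limit_set G" "e \<in> \<zeta>"
    and M: "\<And>p s. p \<in> C \<Longrightarrow> s \<ge> 0 \<Longrightarrow> gromov (e 0) p (e s) \<le> M"
  proof -
    obtain M where "(\<forall>p\<in>C. \<forall>s\<ge>0. gromov (c 0) p (c s) \<le> M) \<or> (\<forall>p\<in>C. \<forall>s\<ge>0. gromov (c 0) p (c (- s)) \<le> M)"
      using line_escapes[OF C line c(2)] by blast
    then show ?thesis
    proof
      assume "\<forall>p\<in>C. \<forall>s\<ge>0. gromov (c 0) p (c s) \<le> M"
      then show ?thesis
        using c by (intro that[of \<eta> c M] \<eta>) (simp_all add: line_joins_def)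
    next
      assume "\<forall>p\<in>C. \<forall>s\<ge>0. gromov (c 0) p (c (- s)) \<le> M"
      then show ?thesis
        using c by (intro that[of \<xi> "\<lambda>t. c (- t)" M] \<xi>) (simp_all add: line_joins_def)
    qed
  qed
  define D where "D = dist x (e 0)"
  have "\<exists>g\<in>G. dist x (g x) > L \<and> (\<forall>p\<in>C. gromov x p (g x) \<le> M + 3 + D)" for L
  proof -
    \<comment> \<open>With \<open>r \<ge> M + 5\<close> the product of \<open>g x\<close> and
      \<open>e r\<close> exceeds \<open>M + 3\<close>, so hyperbolicity must bound the other
      product; \<open>r \<ge> L + D\<close> makes \<open>g x\<close> farther than \<open>L\<close>
      from \<open>x\<close>.\<close>
    define r where "r = max (max 1 (M + 5)) (L + D)"
    have r: "r > 0" "r \<ge> M + 5" "r \<ge> L + D"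
      by (auto simp: r_def)
    obtain g where g: "g \<in> G" "dist (e 0) (g x) > r" "gromov (e 0) (g x) (e r) \<ge> r - 1"
      using limit_set_approach[OF \<zeta> r(1)] by blast
    have "gromov x p (g x) \<le> M + 3 + D" if p: "p \<in> C" for p
    proof -
      have "min (gromov (e 0) p (g x)) (gromov (e 0) (g x) (e r)) \<le> M + 3"
        using gromov_hyperbolic[of "e 0" p "g x" "e r"] M[OF p, of r] r by simp
      then have "gromov (e 0) p (g x) \<le> M + 3"
        using g r by (auto simp: min_def split: if_splits)
      then show ?thesis
        using gromov_change_base[of x p "g x" "e 0"] by (simp add: D_def)
    qed
    moreover have "dist x (g x) > L"
      using g r dist_triangle[of "e 0" "g x" x] by (simp add: D_def dist_commute)
    ultimately show ?thesis using g by blast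
  qed
  then show ?thesis using that by blast
qed

end

section \<open>Ping-pong with a convex-cocompact subgroup of infinite index\<close>

text \<open>The ping-pong identity: \<open>g\<close> sends every \<open>z\<close> that is not in the
  direction of \<open>isom_inv g x\<close> into the direction of \<open>g x\<close>. The products at
  \<open>x\<close> and at \<open>g x\<close> add up to \<open>dist x (g x)\<close>, and applying the
  inverse of \<open>g\<close> rewrites the second.\<close>

lemma (in isom_group) gromov_orbit:
  assumes "g \<in> G"
  shows "gromov x (g x) (g z) = dist x (g x) - gromov x (isom_inv g x) z"
  using iso[OF assms, of x z] dist_inv[OF assms, of x x] dist_inv[OF assms, of x z] dist_inv'[OF assms, of x x]
  by (simp add: gromov_def dist_commute field_simps)

definition left_coset :: "('a \<Rightarrow> 'a) set \<Rightarrow> ('a \<Rightarrow> 'a) \<Rightarrow> ('a \<Rightarrow> 'a) set" where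
  "left_coset H g = (\<circ>) g ` H"

definition right_coset :: "('a \<Rightarrow> 'a) set \<Rightarrow> ('a \<Rightarrow> 'a) \<Rightarrow> ('a \<Rightarrow> 'a) set" where
  "right_coset H g = (\<lambda>h. h \<circ> g) ` H"

text \<open>What is kept of convex cocompactness: a convex invariant set in which the orbit of
  \<open>x\<close> is \<open>R\<close>-dense. Limit sets do not occur any more; all estimates
  concern orbit points and Gromov products.\<close>

locale cocompact_pair = cat_space X + \<Gamma>: isom_group \<Gamma> + \<Gamma>\<^sub>0: isom_group \<Gamma>\<^sub>0
  for X :: "'a::heine_borel itself" and \<Gamma> \<Gamma>\<^sub>0 :: "('a \<Rightarrow> 'a) set" +
  fixes C\<^sub>0 :: "'a set" and x :: 'a and R :: real
  assumes sub: "\<Gamma>\<^sub>0 \<subseteq> \<Gamma>"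
    and finite_ball: "finite {g \<in> \<Gamma>. dist x (g x) \<le> t}"
    and convex: "geodesically_convex C\<^sub>0"
    and x_mem: "x \<in> C\<^sub>0"
    and invariant: "k \<in> \<Gamma>\<^sub>0 \<Longrightarrow> k ` C\<^sub>0 = C\<^sub>0"
    and dense: "p \<in> C\<^sub>0 \<Longrightarrow> \<exists>k\<in>\<Gamma>\<^sub>0. dist (k x) p \<le> R"
    and unbounded: "\<exists>k\<in>\<Gamma>\<^sub>0. dist x (k x) > t"
    and infinite_index: "infinite (right_coset \<Gamma>\<^sub>0 ` \<Gamma>)"
begin

section \<open>Cosets of \<open>\<Gamma>\<^sub>0\<close> and the absence of a direction fixed by
  \<Gamma>\<close>

lemma orbit_mem: "k \<in> \<Gamma>\<^sub>0 \<Longrightarrow> k x \<in> C\<^sub>0"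
  using invariant x_mem by blast

lemma infinite_left_cosets: "infinite (left_coset \<Gamma>\<^sub>0 ` \<Gamma>)"
proof
  assume fin: "finite (left_coset \<Gamma>\<^sub>0 ` \<Gamma>)"
  have "right_coset \<Gamma>\<^sub>0 g = isom_inv ` left_coset \<Gamma>\<^sub>0 (isom_inv g)" if g: "g \<in> \<Gamma>" for g
  proof -
    have inv: "isom_inv (isom_inv g \<circ> k) = isom_inv k \<circ> g" if k: "k \<in> \<Gamma>\<^sub>0" for k
    proof (rule inv_unique_comp)
      show "(isom_inv g \<circ> k) \<circ> (isom_inv k \<circ> g) = id" "(isom_inv k \<circ> g) \<circ> (isom_inv g \<circ> k) = id"
        using g k by (auto simp: fun_eq_iff)
    qed
    have "isom_inv ` left_coset \<Gamma>\<^sub>0 (isom_inv g) = (\<lambda>k. isom_inv k \<circ> g) ` \<Gamma>\<^sub>0"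
      unfolding left_coset_def image_image using inv by (rule image_cong[OF refl])
    also have "\<dots> = (\<lambda>h. h \<circ> g) ` isom_inv ` \<Gamma>\<^sub>0"
      by (simp add: image_image)
    also have "isom_inv ` \<Gamma>\<^sub>0 = \<Gamma>\<^sub>0"
    proof (intro equalityI subsetI)
      fix k assume k: "k \<in> \<Gamma>\<^sub>0"
      have "isom_inv (isom_inv k) = k"
        by (rule inv_unique_comp) (use k in \<open>auto simp: fun_eq_iff\<close>)
      then show "k \<in> isom_inv ` \<Gamma>\<^sub>0"
        using \<Gamma>\<^sub>0.inv_mem[OF k] by (metis imageI)
    qed (use \<Gamma>\<^sub>0.inv_mem in auto)
    finally show ?thesis by (simp only: right_coset_def)
  qed
  then have "right_coset \<Gamma>\<^sub>0 ` \<Gamma> \<subseteq> (`) isom_inv ` left_coset \<Gamma>\<^sub>0 ` \<Gamma>"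
    using \<Gamma>.inv_mem by blast
  with fin infinite_index show False
    by (meson finite_imageI finite_subset)
qed

lemma left_coset_comp:
  assumes "g \<in> \<Gamma>" "h \<in> \<Gamma>" "k \<in> \<Gamma>\<^sub>0" "k' \<in> \<Gamma>\<^sub>0" "g \<circ> k = h \<circ> k'"
  shows "left_coset \<Gamma>\<^sub>0 g = left_coset \<Gamma>\<^sub>0 h"
proof -
  have *: "left_coset \<Gamma>\<^sub>0 (g \<circ> k) = left_coset \<Gamma>\<^sub>0 g" if k: "k \<in> \<Gamma>\<^sub>0" for g k
  proof (intro equalityI subsetI)
    fix f assume "f \<in> left_coset \<Gamma>\<^sub>0 (g \<circ> k)"
    then show "f \<in> left_coset \<Gamma>\<^sub>0 g"
      using \<Gamma>\<^sub>0.comp_mem[OF k] by (auto simp: left_coset_def comp_assoc)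
  next
    fix f assume "f \<in> left_coset \<Gamma>\<^sub>0 g"
    then obtain l where l: "l \<in> \<Gamma>\<^sub>0" "f = g \<circ> l" by (auto simp: left_coset_def)
    have "f = (g \<circ> k) \<circ> (isom_inv k \<circ> l)"
      using l k by (auto simp: fun_eq_iff)
    then show "f \<in> left_coset \<Gamma>\<^sub>0 (g \<circ> k)"
      using \<Gamma>\<^sub>0.comp_mem[OF \<Gamma>\<^sub>0.inv_mem[OF k] l(1)] by (auto simp: left_coset_def)
  qed
  show ?thesis
    using *[of k g] *[of k' h] assms by metis
qed

text \<open>If all of \<open>\<Gamma>\<close> fixed the limit of the \<open>z n\<close>, then this limit would be in the limit set of \<open>\<Gamma>\<^sub>0\<close>.\<close>

lemma fixed_direction_conical:
  assumes fix_dir: "\<And>h K. h \<in> \<Gamma> \<Longrightarrow> \<exists>N. \<forall>n\<ge>N. gromov x (z n) (h (z n)) > K"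
  shows "\<exists>N::nat. \<forall>n\<ge>N. \<exists>k\<in>\<Gamma>\<^sub>0. gromov x (z n) (k x) > K"
proof (rule ccontr)
  assume neg: "\<not> ?thesis"
  \<comment> \<open>This displacement makes the product of \<open>k x\<close> and
    \<open>k (z n)\<close> exceed \<open>K + 3\<close>; since that of \<open>z n\<close> and
    \<open>k (z n)\<close> does as well, the product of \<open>z n\<close> and \<open>k x\<close>
    exceeds \<open>K\<close>.\<close>
  obtain k where k: "k \<in> \<Gamma>\<^sub>0" "dist x (k x) > 2 * K + 3"
    using unbounded by blast
  obtain N where N: "\<forall>n\<ge>N. gromov x (z n) (k (z n)) > K + 3"
    using fix_dir[of k "K + 3"] k sub by auto
  obtain n where "n \<ge> N" and n: "\<And>k. k \<in> \<Gamma>\<^sub>0 \<Longrightarrow> gromov x (z n) (k x) \<le> K"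
    using neg by (metis not_le)
  then have "gromov x (z n) (k (z n)) > K + 3"
    using N by simp
  moreover have "gromov x (k x) (k (z n)) > K + 3"
    using \<Gamma>\<^sub>0.gromov_orbit[OF k(1), of x "z n"] n[OF \<Gamma>\<^sub>0.inv_mem[OF k(1)]] k(2)
    by (simp add: gromov_commute)
  ultimately show False
    using gromov_hyperbolic[of x "z n" "k (z n)" "k x"] n[OF k(1)]
    by (simp add: gromov_commute)
qed

text \<open>The point at distance \<open>T\<close> on the segment from \<open>x\<close> to
  \<open>k' x\<close> lies in \<open>C\<^sub>0\<close>; by \<open>thin\<close> it is nearly on the
  way from \<open>x\<close> to \<open>z\<close>, and density replaces it by an orbit point at cost
  \<open>R\<close>.\<close>

lemma orbit_along_direction:
  assumes k': "k' \<in> \<Gamma>\<^sub>0" "gromov x z (k' x) > T" and T: "T \<ge> 0"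
  shows "\<exists>k\<in>\<Gamma>\<^sub>0. dist x (k x) \<le> T + R \<and> dist (k x) z \<le> dist x z - T + R + 3"
proof -
  obtain a where a: "geodesic_segment a x (k' x)"
    by (rule segment_exists)
  have len: "T \<le> dist x (k' x)"
    using k'(2) gromov_le_dist[of x "k' x" z] by (simp add: gromov_commute)
  have "dist (k' x) z - (dist x (k' x) - T) \<le> dist x z - T"
    using k'(2) by (simp add: gromov_def dist_commute field_simps)
  then have az: "dist (a T) z \<le> dist x z - T + 3"
    using thin[OF a T len, of z] by simp
  have "a T \<in> C\<^sub>0"
    using geodesically_convexD[OF convex x_mem orbit_mem[OF k'(1)] a T len] .
  then obtain k where k: "k \<in> \<Gamma>\<^sub>0" "dist (k x) (a T) \<le> R"
    using dense by blast
  have "dist x (a T) = T"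
    using geodesic_segment_dist(1)[OF a T len] .
  then have "dist x (k x) \<le> T + R" "dist (k x) z \<le> dist x z - T + R + 3"
    using k az dist_triangle[of x "k x" "a T"] dist_triangle[of "k x" z "a T"]
    by (simp_all add: dist_commute)
  with k show ?thesis by blast
qed

text \<open>If \<open>z\<close> is far out in a direction almost fixed by \<open>\<gamma>\<close>, then the orbit of \<open>\<gamma> \<Gamma>\<^sub>0\<close> has a point close to
  the one on the segment from \<open>x\<close> to \<open>z\<close> at distance \<open>S\<close> from \<open>x\<close>; the constants do not depend on \<open>\<gamma>\<close>.\<close>

lemma coset_near_direction:
  assumes \<gamma>: "\<gamma> \<in> \<Gamma>" "dist x (\<gamma> x) \<le> D" and D: "D \<ge> 0" and S: "S = 3 * D"
    and g: "gromov x z (\<gamma> z) > 4 * D"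
    and k': "k' \<in> \<Gamma>\<^sub>0" "gromov x z (k' x) > 4 * D"
  shows "\<exists>k\<in>\<Gamma>\<^sub>0. dist (\<gamma> (k x)) z \<le> dist x z - S + R + 9 \<and> dist (\<gamma> (k x)) x \<le> S + R + 15"
proof -
  define \<beta> where "\<beta> = dist (\<gamma> x) z - dist x z"
  have \<beta>: "- D \<le> \<beta>" "\<beta> \<le> D"
    using \<gamma>(2) dist_triangle[of "\<gamma> x" z x] dist_triangle[of x z "\<gamma> x"]
    by (auto simp: \<beta>_def dist_commute)
  \<comment> \<open>Seen from \<gamma> x, the distance to \<open>z\<close> differs by \<beta> from
    the one seen from \<open>x\<close>. Correcting the depth by \<beta> makes the depth of
    \<open>w\<close> measured from \<open>x\<close> equal to \<open>S\<close>, independently of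
    \<gamma>.\<close>
  define T where "T = S + \<beta>"
  have T: "0 \<le> T" "T \<le> 4 * D"
    using \<beta> S D by (auto simp: T_def)
  then obtain k where k: "k \<in> \<Gamma>\<^sub>0" "dist x (k x) \<le> T + R" "dist (k x) z \<le> dist x z - T + R + 3"
    using orbit_along_direction[OF k'(1), where z = z and T = T] k' by auto
  define w where "w = \<gamma> (k x)"
  have w1: "dist w (\<gamma> x) \<le> T + R" and w2: "dist w (\<gamma> z) \<le> dist x z - T + R + 3"
    and xz: "dist (\<gamma> x) (\<gamma> z) = dist x z"
    using k \<Gamma>.iso[OF \<gamma>(1)] by (simp_all add: w_def dist_commute)
  have "dist z (\<gamma> z) \<le> dist x z + dist x (\<gamma> z) - 8 * D"
    using g by (simp add: gromov_def field_simps)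
  moreover have "dist x (\<gamma> z) \<le> D + dist x z"
    using \<gamma>(2) xz dist_triangle[of x "\<gamma> z" "\<gamma> x"] by simp
  \<comment> \<open>Here \<open>S = 3 * D\<close> enters:
    \<open>S + \<beta> - 7 * D \<le> - S\<close>.\<close>
  ultimately have "dist w (\<gamma> x) + dist z (\<gamma> z) \<le> 2 * dist x z - S + R + 3"
    using w1 \<beta> S by (simp add: T_def)
  moreover have "dist w (\<gamma> z) + dist z (\<gamma> x) \<le> 2 * dist x z - S + R + 3"
    using w2 by (simp add: T_def \<beta>_def dist_commute)
  ultimately have wz: "dist w z \<le> dist x z - S + R + 9"
    using four_point[of w z "\<gamma> x" "\<gamma> z"] xz by simp
  have "dist w (\<gamma> x) + dist x z \<le> S + R + 9 + dist (\<gamma> x) z"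
    using w1 by (simp add: T_def \<beta>_def)
  moreover have "dist w z + dist x (\<gamma> x) \<le> S + R + 9 + dist (\<gamma> x) z"
    using wz \<gamma>(2) \<beta> S D by (simp add: \<beta>_def)
  ultimately have "dist w x \<le> S + R + 15"
    using four_point[of w x "\<gamma> x" z] by simp
  with k wz show ?thesis by (auto simp: w_def)
qed

text \<open>If every element of \<Gamma> fixed the direction of the \<open>z n\<close>, then by
  \<open>coset_near_direction\<close> any finite family of cosets
  \<gamma>\<open>\<Gamma>\<^sub>0\<close> would have orbit points pairwise within
  \<open>2 * R + 30\<close>. Infinite index supplies more cosets than there are group elements of
  that displacement.\<close>

lemma direction_moved:
  "\<exists>h\<in>\<Gamma>. \<exists>K. \<forall>N::nat. \<exists>n\<ge>N. gromov x (z n) (h (z n)) \<le> K"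
proof (rule ccontr)
  assume neg: "\<not> ?thesis"
  have fix_dir: "\<exists>N::nat. \<forall>n\<ge>N. gromov x (z n) (h (z n)) > K" if "h \<in> \<Gamma>" for h K
    using neg that by (meson not_le)
  \<comment> \<open>The radius is what \<open>four_point\<close> gives for two points with the
    bounds of \<open>coset_near_direction\<close>: \<open>(R + 9) + (R + 15) + 6\<close>.\<close>
  define B where "B = {g \<in> \<Gamma>. dist x (g x) \<le> 2 * R + 30}"
  have B: "finite B"
    unfolding B_def by (rule finite_ball)
  obtain Q where Q: "Q \<subseteq> left_coset \<Gamma>\<^sub>0 ` \<Gamma>" "finite Q" "card Q = Suc (card B)"
    using infinite_arbitrarily_large[OF infinite_left_cosets, of "Suc (card B)"] by blast
  then obtain J where J: "J \<subseteq> \<Gamma>" "inj_on (left_coset \<Gamma>\<^sub>0) J" "Q = left_coset \<Gamma>\<^sub>0 ` J"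
    by (auto simp: subset_image_inj)
  have finJ: "finite J" and cardJ: "card J = Suc (card B)"
    using Q J finite_imageD[of "left_coset \<Gamma>\<^sub>0" J] card_image[OF J(2)] by auto
  define D where "D = Max (insert 0 ((\<lambda>\<gamma>. dist x (\<gamma> x)) ` J))"
  have D: "D \<ge> 0" "\<And>\<gamma>. \<gamma> \<in> J \<Longrightarrow> dist x (\<gamma> x) \<le> D"
    unfolding D_def using finJ by (auto intro!: Max_ge)
  obtain n k' where n: "\<And>\<gamma>. \<gamma> \<in> J \<Longrightarrow> gromov x (z n) (\<gamma> (z n)) > 4 * D"
    and k': "k' \<in> \<Gamma>\<^sub>0" "gromov x (z n) (k' x) > 4 * D"
  proof -
    have "\<forall>\<gamma>\<in>J. eventually (\<lambda>n. gromov x (z n) (\<gamma> (z n)) > 4 * D) sequentially"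
      using fix_dir J(1) unfolding eventually_sequentially by blast
    then have "eventually (\<lambda>n. \<forall>\<gamma>\<in>J. gromov x (z n) (\<gamma> (z n)) > 4 * D) sequentially"
      by (simp add: eventually_ball_finite finJ)
    moreover have "eventually (\<lambda>n. \<exists>k\<in>\<Gamma>\<^sub>0. gromov x (z n) (k x) > 4 * D) sequentially"
      using fixed_direction_conical[of z "4 * D"] fix_dir unfolding eventually_sequentially by blast
    ultimately have "eventually (\<lambda>n. (\<forall>\<gamma>\<in>J. gromov x (z n) (\<gamma> (z n)) > 4 * D) \<and>
        (\<exists>k\<in>\<Gamma>\<^sub>0. gromov x (z n) (k x) > 4 * D)) sequentially"
      by (rule eventually_conj)
    then obtain n where "(\<forall>\<gamma>\<in>J. gromov x (z n) (\<gamma> (z n)) > 4 * D) \<and>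
        (\<exists>k\<in>\<Gamma>\<^sub>0. gromov x (z n) (k x) > 4 * D)"
      unfolding eventually_sequentially by blast
    then show ?thesis using that by blast
  qed
  define Z where "Z = z n"
  have "\<forall>\<gamma>\<in>J. \<exists>k\<in>\<Gamma>\<^sub>0. dist (\<gamma> (k x)) Z \<le> dist x Z - 3 * D + R + 9 \<and> dist (\<gamma> (k x)) x \<le> 3 * D + R + 15"
  proof
    fix \<gamma> assume "\<gamma> \<in> J"
    with J(1) show "\<exists>k\<in>\<Gamma>\<^sub>0. dist (\<gamma> (k x)) Z \<le> dist x Z - 3 * D + R + 9 \<and> dist (\<gamma> (k x)) x \<le> 3 * D + R + 15"
      unfolding Z_def by (intro coset_near_direction[OF _ D(2) D(1) refl n k']) auto
  qed
  then obtain \<kappa> where \<kappa>: "\<And>\<gamma>. \<gamma> \<in> J \<Longrightarrow> \<kappa> \<gamma> \<in> \<Gamma>\<^sub>0"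
    and \<kappa>1: "\<And>\<gamma>. \<gamma> \<in> J \<Longrightarrow> dist (\<gamma> (\<kappa> \<gamma> x)) Z \<le> dist x Z - 3 * D + R + 9"
    and \<kappa>2: "\<And>\<gamma>. \<gamma> \<in> J \<Longrightarrow> dist (\<gamma> (\<kappa> \<gamma> x)) x \<le> 3 * D + R + 15"
    by metis
  define f where "f \<gamma> = \<gamma> \<circ> \<kappa> \<gamma>" for \<gamma>
  have f: "f \<gamma> \<in> \<Gamma>" if "\<gamma> \<in> J" for \<gamma>
    unfolding f_def using that J(1) \<kappa> sub by (intro \<Gamma>.comp_mem) auto
  have close: "dist (f \<gamma> x) (f \<gamma>' x) \<le> 2 * R + 30" if "\<gamma> \<in> J" "\<gamma>' \<in> J" for \<gamma> \<gamma>'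
    using four_point[of "f \<gamma> x" "f \<gamma>' x" x Z] \<kappa>1[OF that(1)] \<kappa>1[OF that(2)] \<kappa>2[OF that(1)] \<kappa>2[OF that(2)]
    by (auto simp: f_def)
  have "J \<noteq> {}"
    using cardJ by auto
  then obtain \<gamma>1 where \<gamma>1: "\<gamma>1 \<in> J" by blast
  \<comment> \<open>Relative positions with respect to one member of the family; they have
    displacement at most \<open>2 * R + 30\<close>, and equal ones come from equal cosets.\<close>
  define F where "F \<gamma> = isom_inv (f \<gamma>1) \<circ> f \<gamma>" for \<gamma>
  have "F ` J \<subseteq> B"
  proof (intro image_subsetI)
    fix \<gamma> assume "\<gamma> \<in> J"
    then show "F \<gamma> \<in> B"
      using close[OF \<gamma>1] \<Gamma>.dist_inv'[OF f[OF \<gamma>1]] \<Gamma>.comp_mem[OF \<Gamma>.inv_mem[OF f[OF \<gamma>1]] f]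
      by (simp add: B_def F_def)
  qed
  moreover have "inj_on F J"
  proof (rule inj_onI)
    fix \<gamma> \<gamma>' assume \<gamma>: "\<gamma> \<in> J" "\<gamma>' \<in> J" and "F \<gamma> = F \<gamma>'"
    then have "f \<gamma>1 \<circ> F \<gamma> = f \<gamma>1 \<circ> F \<gamma>'" by simp
    then have "f \<gamma> = f \<gamma>'"
      using f[OF \<gamma>1] by (simp add: F_def fun_eq_iff)
    then have "left_coset \<Gamma>\<^sub>0 \<gamma> = left_coset \<Gamma>\<^sub>0 \<gamma>'"
      using left_coset_comp[of \<gamma> \<gamma>' "\<kappa> \<gamma>" "\<kappa> \<gamma>'"] J(1) \<kappa> \<gamma> by (auto simp: f_def)
    then show "\<gamma> = \<gamma>'"
      using J(2) \<gamma> by (auto dest: inj_onD)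
  qed
  ultimately have "card J \<le> card B"
    using B by (metis card_inj_on_le)
  with cardJ show False by simp
qed

lemma finite_ping_pong:
  assumes escape: "\<And>L. \<exists>g\<in>\<Gamma>. dist x (g x) > L \<and> (\<forall>p\<in>C. gromov x p (g x) \<le> m)"
  shows "\<exists>F m'. finite F \<and> F \<subseteq> \<Gamma> \<and> (\<forall>z. \<exists>a\<in>F. \<forall>p\<in>C. gromov x p (a z) \<le> m')"
proof -
  obtain g where g: "\<And>n::nat. g n \<in> \<Gamma>" "\<And>n. dist x (g n x) > real n"
    "\<And>n p. p \<in> C \<Longrightarrow> gromov x p (g n x) \<le> m"
  proof -
    have "\<forall>n::nat. \<exists>g. g \<in> \<Gamma> \<and> dist x (g x) > real n \<and> (\<forall>p\<in>C. gromov x p (g x) \<le> m)"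
      using escape by blast
    from choice[OF this] show ?thesis
      using that by blast
  qed
  obtain h K where h: "h \<in> \<Gamma>"
    and K: "\<And>N. \<exists>n\<ge>N. gromov x (isom_inv (g n) x) (h (isom_inv (g n) x)) \<le> K"
    using direction_moved[of "\<lambda>n. isom_inv (g n) x"] by auto
  define e where "e = dist x (h x)"
  define m2 where "m2 = m + e"
  \<comment> \<open>Subtracting the bound \<open>K + 3\<close> of the inverse direction must leave
    more than \<open>m2 + 3\<close>; the extra \<open>e\<close> covers the passage from
    \<open>g1 x\<close> to \<open>g2 x\<close>.\<close>
  obtain N :: nat where N: "real N > m2 + 3 + e + (K + 3)"
    using reals_Archimedean2 by blast
  obtain n where n: "n \<ge> N" "gromov x (isom_inv (g n) x) (h (isom_inv (g n) x)) \<le> K"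
    using K by blast
  define g1 where "g1 = g n"
  \<comment> \<open>Precomposing with the inverse of \<open>h\<close> moves the orbit point only by
    \<open>e\<close>, but replaces the inverse orbit point by its image under \<open>h\<close>, a
    different direction by the choice of \<open>h\<close>.\<close>
  define g2 where "g2 = g n \<circ> isom_inv h"
  have mem: "g1 \<in> \<Gamma>" "g2 \<in> \<Gamma>"
    using g h by (auto simp: g1_def g2_def intro: \<Gamma>.comp_mem \<Gamma>.inv_mem)
  have "isom_inv g2 = h \<circ> isom_inv (g n)"
    by (rule inv_unique_comp) (use g(1) h in \<open>auto simp: g2_def fun_eq_iff\<close>)
  then have inv12: "gromov x (isom_inv g1 x) (isom_inv g2 x) \<le> K"
    using n by (simp add: g1_def)
  have d12: "dist (g1 x) (g2 x) = e"
    using \<Gamma>.iso[OF g(1), of n x "isom_inv h x"] \<Gamma>.dist_inv'[OF h, of x x]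
    by (simp add: g1_def g2_def e_def dist_commute)
  have e: "e \<ge> 0" by (simp add: e_def)
  have far: "dist x (a x) > m2 + 3 + (K + 3)" if "a \<in> {g1, g2}" for a
  proof -
    have "dist x (g1 x) > m2 + 3 + e + (K + 3)"
      using g(2)[of n] of_nat_mono[OF n(1), where 'a = real] N unfolding g1_def by linarith
    moreover from this have "dist x (g2 x) > m2 + 3 + (K + 3)"
      using d12 dist_triangle[of x "g1 x" "g2 x"] unfolding dist_commute[of "g2 x" "g1 x"] by linarith
    ultimately show ?thesis
      using that e by fastforce
  qed
  have prod: "gromov x p (a x) \<le> m2" if "a \<in> {g1, g2}" "p \<in> C" for a p
  proof -
    have "gromov x p (g1 x) \<le> m"
      unfolding g1_def by (rule g(3)[OF that(2)])
    moreover from this have "gromov x p (g2 x) \<le> m2"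
      using gromov_change_point[of x "g2 x" p "g1 x"] d12
      unfolding m2_def dist_commute[of "g2 x" "g1 x"] gromov_commute[of x p] by linarith
    ultimately show ?thesis
      using that e unfolding m2_def by fastforce
  qed
  have "\<exists>a\<in>{g1, g2}. \<forall>p\<in>C. gromov x p (a z) \<le> m2 + 3" for z
  proof -
    obtain a where a: "a \<in> {g1, g2}" "gromov x (isom_inv a x) z \<le> K + 3"
      using gromov_hyperbolic[of x "isom_inv g1 x" z "isom_inv g2 x"] inv12
      by (fastforce simp: min_def gromov_commute split: if_splits)
    have "gromov x p (a z) \<le> m2 + 3" if p: "p \<in> C" for p
    proof -
      have "a \<in> \<Gamma>" using a mem by auto
      then have "gromov x (a z) (a x) > m2 + 3"
        using \<Gamma>.gromov_orbit[of a x z] a(2) far[OF a(1)] by (simp add: gromov_commute)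
      then show ?thesis
        using gromov_hyperbolic[of x p "a z" "a x"] prod[OF a(1) p] by (simp add: min_def split: if_splits)
    qed
    with a(1) show ?thesis by blast
  qed
  moreover have "finite {g1, g2}" "{g1, g2} \<subseteq> \<Gamma>"
    using mem by auto
  ultimately show ?thesis by blast
qed

text \<open>Every right coset of \<open>\<Gamma>\<^sub>0\<close> contains an element
  \<open>g\<close> for which \<open>x\<close> is almost the nearest point to \<open>g x\<close> in
  the orbit of \<open>\<Gamma>\<^sub>0\<close>. Infinite index and finiteness of balls make some of
  these move \<open>x\<close> far, and near minimality bounds the products of \<open>g x\<close>
  with the convex set.\<close>

lemma escape_from_hull:
  "\<exists>g\<in>\<Gamma>. dist x (g x) > L \<and> (\<forall>p\<in>C\<^sub>0. gromov x p (g x) \<le> R + 4)"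
proof -
  define A where "A = {g \<in> \<Gamma>. \<forall>k\<in>\<Gamma>\<^sub>0. dist x (g x) \<le> dist (k x) (g x) + 1}"
  have near: "\<exists>k\<in>\<Gamma>\<^sub>0. k \<circ> \<gamma> \<in> A" if \<gamma>: "\<gamma> \<in> \<Gamma>" for \<gamma>
  proof -
    let ?d = "\<lambda>k. dist x (k (\<gamma> x))"
    \<comment> \<open>Rounding down gives a minimum over the natural numbers; it costs the
      \<open>+ 1\<close> in the definition of \<open>A\<close>.\<close>
    obtain k where k: "k \<in> \<Gamma>\<^sub>0" "\<And>l. l \<in> \<Gamma>\<^sub>0 \<Longrightarrow> nat \<lfloor>?d k\<rfloor> \<le> nat \<lfloor>?d l\<rfloor>"
      using ex_has_least_nat[of "\<lambda>k. k \<in> \<Gamma>\<^sub>0" id "\<lambda>k. nat \<lfloor>?d k\<rfloor>"] \<Gamma>\<^sub>0.id_mem by auto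
    have "dist x ((k \<circ> \<gamma>) x) \<le> dist (l x) ((k \<circ> \<gamma>) x) + 1" if l: "l \<in> \<Gamma>\<^sub>0" for l
    proof -
      have "isom_inv l \<circ> k \<in> \<Gamma>\<^sub>0"
        using \<Gamma>\<^sub>0.comp_mem[OF \<Gamma>\<^sub>0.inv_mem[OF l] k(1)] .
      from k(2)[OF this] have "\<lfloor>?d k\<rfloor> \<le> \<lfloor>?d (isom_inv l \<circ> k)\<rfloor>"
        by (simp add: nat_le_eq_zle)
      then have "?d k \<le> ?d (isom_inv l \<circ> k) + 1"
        by linarith
      also have "?d (isom_inv l \<circ> k) = dist (l x) (k (\<gamma> x))"
        using \<Gamma>\<^sub>0.dist_inv'[OF l, of x "k (\<gamma> x)"] by simp
      finally show ?thesis by simp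
    qed
    moreover have "k \<circ> \<gamma> \<in> \<Gamma>"
      using \<Gamma>.comp_mem k(1) \<gamma> sub by blast
    ultimately show ?thesis
      using k(1) by (auto simp: A_def)
  qed
  have "\<not> A \<subseteq> {g \<in> \<Gamma>. dist x (g x) \<le> L}"
  proof
    assume "A \<subseteq> {g \<in> \<Gamma>. dist x (g x) \<le> L}"
    then have "finite A"
      using finite_ball finite_subset by blast
    have "right_coset \<Gamma>\<^sub>0 ` \<Gamma> \<subseteq> right_coset \<Gamma>\<^sub>0 ` A"
    proof (rule image_subsetI)
      fix \<gamma> assume "\<gamma> \<in> \<Gamma>"
      then obtain k where k: "k \<in> \<Gamma>\<^sub>0" "k \<circ> \<gamma> \<in> A"
        using near by blast
      have "right_coset \<Gamma>\<^sub>0 \<gamma> = right_coset \<Gamma>\<^sub>0 (k \<circ> \<gamma>)"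
      proof (intro equalityI subsetI)
        fix f assume "f \<in> right_coset \<Gamma>\<^sub>0 \<gamma>"
        then obtain l where l: "l \<in> \<Gamma>\<^sub>0" "f = l \<circ> \<gamma>" by (auto simp: right_coset_def)
        have "f = (l \<circ> isom_inv k) \<circ> (k \<circ> \<gamma>)"
          using l k by (auto simp: fun_eq_iff)
        then show "f \<in> right_coset \<Gamma>\<^sub>0 (k \<circ> \<gamma>)"
          using \<Gamma>\<^sub>0.comp_mem[OF l(1) \<Gamma>\<^sub>0.inv_mem[OF k(1)]] by (auto simp: right_coset_def)
      next
        fix f assume "f \<in> right_coset \<Gamma>\<^sub>0 (k \<circ> \<gamma>)"
        then show "f \<in> right_coset \<Gamma>\<^sub>0 \<gamma>"
          using \<Gamma>\<^sub>0.comp_mem[OF _ k(1)] by (auto simp: right_coset_def comp_assoc[symmetric])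
      qed
      with k show "right_coset \<Gamma>\<^sub>0 \<gamma> \<in> right_coset \<Gamma>\<^sub>0 ` A" by blast
    qed
    then show False
      using infinite_index \<open>finite A\<close> by (meson finite_imageI finite_subset)
  qed
  then obtain g where "g \<in> A" "g \<notin> {g \<in> \<Gamma>. dist x (g x) \<le> L}"
    by blast
  then have g: "g \<in> A" "dist x (g x) > L"
    by (simp_all add: A_def)
  have "gromov x p (g x) \<le> R + 4" if p: "p \<in> C\<^sub>0" for p
  proof -
    obtain a where a: "geodesic_segment a x p"
      by (rule segment_exists)
    define w where "w = a (gromov x p (g x))"
    have "w \<in> C\<^sub>0"
      unfolding w_def using geodesically_convexD[OF convex x_mem p a gromov_nonneg gromov_le_dist] .
    then obtain k where k: "k \<in> \<Gamma>\<^sub>0" "dist (k x) w \<le> R"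
      using dense by blast
    have "dist x (g x) \<le> dist (k x) (g x) + 1"
      using g k by (simp add: A_def)
    also have "dist (k x) (g x) \<le> R + dist w (g x)"
      using k dist_triangle[of "k x" "g x" w] by simp
    also have "dist w (g x) \<le> gromov (g x) x p + 3"
      unfolding w_def by (rule near_segment[OF a])
    finally show ?thesis
      by (simp add: gromov_def dist_commute field_simps)
  qed
  with g show ?thesis by (auto simp: A_def)
qed

end

section \<open>Counting double classes\<close>

definition double_class :: "('a \<Rightarrow> 'a) set \<Rightarrow> ('a \<Rightarrow> 'a) set \<Rightarrow> ('a \<Rightarrow> 'a) \<Rightarrow> ('a \<Rightarrow> 'a) set" where
  "double_class H K g = {h \<circ> g \<circ> k |h k. h \<in> H \<and> k \<in> K}"

lemma double_classes_eq: "double_classes H G K = double_class H K ` G"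
  unfolding double_classes_def
  by (rule image_cong[OF refl]) (auto simp: double_class_def r_coset_def set_mult_def isometry_group_def)

lemma (in isom_group) setdist_iso:
  assumes "g \<in> G"
  shows "setdist (g ` S) (g ` T) = setdist S T"
proof -
  have "{dist y z |y z. y \<in> g ` S \<and> z \<in> g ` T} = {dist (g y) (g z) |y z. y \<in> S \<and> z \<in> T}"
    by blast
  then show ?thesis by (simp add: setdist_def iso[OF assms])
qed

lemma segment_meets_frontier:
  fixes a :: "real \<Rightarrow> 'a::metric_space"
  assumes a: "geodesic_segment a y z" and "y \<in> C" "z \<notin> C"
  shows "\<exists>w\<in>frontier C. dist w z \<le> dist y z"
proof -
  let ?I = "{0..dist y z}"
  have "continuous_on ?I a"
    unfolding continuous_on_iff
  proof (intro ballI allI impI)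
    fix s and e :: real assume s: "s \<in> ?I" and e: "e > 0"
    have "dist (a t) (a s) < e" if "t \<in> ?I" "dist t s < e" for t
      using a s that unfolding geodesic_segment_def by (simp add: dist_real_def)
    with e show "\<exists>d>0. \<forall>t\<in>?I. dist t s < d \<longrightarrow> dist (a t) (a s) < e" by blast
  qed
  then have "connected (a ` ?I)"
    by (intro connected_continuous_image) auto
  moreover have "y \<in> a ` ?I"
    by (rule image_eqI[of _ _ 0]) (use a in \<open>auto simp: geodesic_segment_def\<close>)
  moreover have "z \<in> a ` ?I"
    by (rule image_eqI[of _ _ "dist y z"]) (use a in \<open>auto simp: geodesic_segment_def\<close>)
  ultimately have "a ` ?I \<inter> frontier C \<noteq> {}"
    using assms(2,3) by (intro connected_Int_frontier) blast+
  then obtain s where "s \<in> ?I" "a s \<in> frontier C" by blast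
  then show ?thesis
    using geodesic_segment_dist(2)[OF a, of s] by (intro bexI[of _ "a s"]) auto
qed

text \<open>\<open>escape\<close> stands for the hypothesis that \<open>C\<close> does not contain
  the hull of the limit set of \<Gamma>, and \<open>frontier_dense\<close> for the cocompactness of
  the frontier under the stabilizer.\<close>

locale double_class_count = cocompact_pair X \<Gamma> \<Gamma>\<^sub>0 C\<^sub>0 x R
  for X :: "'a::heine_borel itself" and \<Gamma> \<Gamma>\<^sub>0 :: "('a \<Rightarrow> 'a) set" and C\<^sub>0 x R +
  fixes C :: "'a set" and H :: "('a \<Rightarrow> 'a) set" and R' m :: real
  assumes H_def: "H = set_stabilizer \<Gamma> C"
    and C_nonempty: "C \<noteq> {}"
    and frontier_dense: "p \<in> frontier C \<Longrightarrow> \<exists>h\<in>H. dist (h x) p \<le> R'"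
    and escape: "\<exists>g\<in>\<Gamma>. dist x (g x) > L \<and> (\<forall>p\<in>C. gromov x p (g x) \<le> m)"
    and finite_meet: "finite {r \<in> double_class H \<Gamma>\<^sub>0 ` \<Gamma>. \<exists>\<gamma>\<in>r. C \<inter> \<gamma> ` C\<^sub>0 \<noteq> {}}"
begin

sublocale H: isom_group H
  unfolding H_def by (rule \<Gamma>.set_stabilizer_isom_group)

lemma H_sub: "H \<subseteq> \<Gamma>" and H_image: "h \<in> H \<Longrightarrow> h ` C = C"
  by (auto simp: H_def set_stabilizer_def)

abbreviation cls :: "('a \<Rightarrow> 'a) \<Rightarrow> ('a \<Rightarrow> 'a) set" where
  "cls \<equiv> double_class H \<Gamma>\<^sub>0"

abbreviation cdist :: "('a \<Rightarrow> 'a) set \<Rightarrow> real" where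
  "cdist \<equiv> class_distance C C\<^sub>0"

lemma self_mem_cls: "g \<in> cls g"
proof -
  have "g = id \<circ> g \<circ> id" by simp
  then show ?thesis
    unfolding double_class_def using H.id_mem \<Gamma>\<^sub>0.id_mem by blast
qed

lemma cls_sub: "g \<in> \<Gamma> \<Longrightarrow> cls g \<subseteq> \<Gamma>"
  using H_sub sub \<Gamma>.comp_mem unfolding double_class_def by blast

lemma cls_eq:
  assumes "g' \<in> cls g"
  shows "cls g' = cls g"
proof -
  obtain h k where hk: "h \<in> H" "k \<in> \<Gamma>\<^sub>0" "g' = h \<circ> g \<circ> k"
    using assms by (auto simp: double_class_def)
  have "h' \<circ> g' \<circ> k' \<in> cls g" if "h' \<in> H" "k' \<in> \<Gamma>\<^sub>0" for h' k'
  proof -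
    have "h' \<circ> g' \<circ> k' = (h' \<circ> h) \<circ> g \<circ> (k \<circ> k')"
      by (simp add: hk fun_eq_iff)
    then show ?thesis
      unfolding double_class_def using H.comp_mem[OF that(1) hk(1)] \<Gamma>\<^sub>0.comp_mem[OF hk(2) that(2)] by blast
  qed
  moreover have "h' \<circ> g \<circ> k' \<in> cls g'" if "h' \<in> H" "k' \<in> \<Gamma>\<^sub>0" for h' k'
  proof -
    have "h' \<circ> g \<circ> k' = (h' \<circ> isom_inv h) \<circ> g' \<circ> (isom_inv k \<circ> k')"
      using hk by (simp add: fun_eq_iff)
    then show ?thesis
      unfolding double_class_def
      using H.comp_mem[OF that(1) H.inv_mem[OF hk(1)]] \<Gamma>\<^sub>0.comp_mem[OF \<Gamma>\<^sub>0.inv_mem[OF hk(2)] that(2)]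
      by blast
  qed
  ultimately show ?thesis
    by (auto simp: double_class_def[of H \<Gamma>\<^sub>0 g] double_class_def[of H \<Gamma>\<^sub>0 g'])
qed

text \<open>Justifies the definite description in \<open>class_distance\<close>: on the left
  \<open>h\<close> preserves \<open>C\<close> and distances, on the right \<open>k\<close> preserves
  \<open>C\<^sub>0\<close>.\<close>

lemma cdist_cls: "cdist (cls g) = setdist C (g ` C\<^sub>0)"
proof -
  have "setdist C (g' ` C\<^sub>0) = setdist C (g ` C\<^sub>0)" if g': "g' \<in> cls g" for g'
  proof -
    obtain h k where hk: "h \<in> H" "k \<in> \<Gamma>\<^sub>0" "g' = h \<circ> g \<circ> k"
      using g' by (auto simp: double_class_def)
    have "g' ` C\<^sub>0 = h ` g ` k ` C\<^sub>0"
      by (simp add: hk(3) image_comp)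
    then have "setdist C (g' ` C\<^sub>0) = setdist (h ` C) (h ` g ` C\<^sub>0)"
      using hk by (simp add: invariant H_image)
    then show ?thesis
      using H.setdist_iso[OF hk(1)] by simp
  qed
  then show ?thesis
    unfolding class_distance_def using self_mem_cls[of g] by (intro the_equality) (blast, metis)
qed

section \<open>Upper bound by short representatives, lower bound by transverse elements\<close>

definition orbit_ball :: "real \<Rightarrow> ('a \<Rightarrow> 'a) set" where
  "orbit_ball t = {g \<in> \<Gamma>. dist x (g x) \<le> t}"

definition near_classes :: "real \<Rightarrow> ('a \<Rightarrow> 'a) set set" where
  "near_classes t = {r \<in> cls ` \<Gamma>. cdist r \<le> t}"

definition meeting :: "('a \<Rightarrow> 'a) set set" where
  "meeting = {r \<in> cls ` \<Gamma>. \<exists>\<gamma>\<in>r. C \<inter> \<gamma> ` C\<^sub>0 \<noteq> {}}"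

lemma finite_orbit_ball: "finite (orbit_ball t)"
  unfolding orbit_ball_def by (rule finite_ball)

text \<open>An almost shortest segment from \<open>C\<close> to \<gamma>\<open>C\<^sub>0\<close>
  crosses the frontier of \<open>C\<close>. Elements of \<open>H\<close> and
  \<open>\<Gamma>\<^sub>0\<close> bring orbit points within \<open>R'\<close> of the crossing point
  and within \<open>R\<close> of the far end; the remaining 1 is the slack for a distance that may
  not be attained.\<close>

lemma short_representative:
  assumes r: "r \<in> near_classes t" "r \<notin> meeting"
  shows "\<exists>g\<in>orbit_ball (t + (1 + R + R')). r = cls g"
proof -
  obtain \<gamma> where \<gamma>: "\<gamma> \<in> \<Gamma>" "r = cls \<gamma>" "setdist C (\<gamma> ` C\<^sub>0) \<le> t"
    using r by (auto simp: near_classes_def cdist_cls)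
  have disj: "C \<inter> \<gamma> ` C\<^sub>0 = {}"
    using r(2) \<gamma> self_mem_cls[of \<gamma>] by (auto simp: meeting_def)
  have "setdist C (\<gamma> ` C\<^sub>0) < t + 1" "\<gamma> ` C\<^sub>0 \<noteq> {}"
    using \<gamma>(3) x_mem by auto
  then obtain y z where yz: "y \<in> C" "z \<in> \<gamma> ` C\<^sub>0" "dist y z < t + 1"
    using setdist_ltE[OF _ C_nonempty] by metis
  obtain a where a: "geodesic_segment a y z"
    by (rule segment_exists)
  have "z \<notin> C" using disj yz by blast
  then obtain w where w: "w \<in> frontier C" "dist w z \<le> dist y z"
    using segment_meets_frontier[OF a yz(1)] by blast
  obtain h where h: "h \<in> H" "dist (h x) w \<le> R'"
    using frontier_dense[OF w(1)] by blast
  obtain q where q: "q \<in> C\<^sub>0" "z = \<gamma> q"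
    using yz by blast
  obtain k where k: "k \<in> \<Gamma>\<^sub>0" "dist (k x) q \<le> R"
    using dense[OF q(1)] by blast
  define g where "g = isom_inv h \<circ> \<gamma> \<circ> k"
  have "g \<in> cls \<gamma>"
    unfolding double_class_def g_def using H.inv_mem[OF h(1)] k by blast
  then have "r = cls g" "g \<in> \<Gamma>"
    using cls_eq cls_sub \<gamma> by blast+
  moreover have "dist x (g x) \<le> t + (1 + R + R')"
  proof -
    have "dist x (g x) = dist (h x) (\<gamma> (k x))"
      using H.dist_inv'[OF h(1)] by (simp add: g_def)
    moreover have "dist z (\<gamma> (k x)) \<le> R"
      using k q \<Gamma>.iso[OF \<gamma>(1)] by (simp add: dist_commute)
    ultimately show ?thesis
      using h w yz dist_triangle[of "h x" "\<gamma> (k x)" w] dist_triangle[of w "\<gamma> (k x)" z] by simp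
  qed
  ultimately show ?thesis by (auto simp: orbit_ball_def)
qed

lemma classes_upper:
  "finite (near_classes t)" "card (near_classes t) \<le> card meeting + card (orbit_ball (t + (1 + R + R')))"
proof -
  have sub: "near_classes t \<subseteq> meeting \<union> cls ` orbit_ball (t + (1 + R + R'))"
    using short_representative by blast
  have fin: "finite meeting"
    unfolding meeting_def by (rule finite_meet)
  then show "finite (near_classes t)"
    using sub finite_orbit_ball by (meson finite_UnI finite_imageI finite_subset)
  have "card (near_classes t) \<le> card (meeting \<union> cls ` orbit_ball (t + (1 + R + R')))"
    using sub fin finite_orbit_ball by (intro card_mono) auto
  also have "\<dots> \<le> card meeting + card (cls ` orbit_ball (t + (1 + R + R')))"
    by (rule card_Un_le)
  also have "card (cls ` orbit_ball (t + (1 + R + R'))) \<le> card (orbit_ball (t + (1 + R + R')))"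
    by (rule card_image_le[OF finite_orbit_ball])
  finally show "card (near_classes t) \<le> card meeting + card (orbit_ball (t + (1 + R + R')))" by simp
qed

text \<open>For these \<open>g\<close>, every geodesic from \<open>C\<close> to \<open>g C\<^sub>0\<close> nearly contains the segment from \<open>x\<close> to \<open>g x\<close>.\<close>

definition transverse :: "real \<Rightarrow> ('a \<Rightarrow> 'a) set" where
  "transverse M = {g \<in> \<Gamma>. (\<forall>p\<in>C. gromov x p (g x) \<le> M) \<and> (\<forall>q\<in>C\<^sub>0. gromov x q (isom_inv g x) \<le> M) \<and>
     dist x (g x) > 2 * M + 3}"

text \<open>Apply \<open>four_point\<close> to \<open>p\<close>, \<open>g x\<close>,
  \<open>g q\<close>, \<open>x\<close>: the length condition in \<open>transverse\<close> rules out
  the second alternative of the maximum.\<close>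

lemma transverse_dist:
  assumes g: "g \<in> transverse M" and p: "p \<in> C" and q: "q \<in> C\<^sub>0"
  shows "dist x p + dist x (g x) + dist x q - (4 * M + 6) \<le> dist p (g q)"
proof -
  have gG: "g \<in> \<Gamma>" and 1: "gromov x p (g x) \<le> M" and 2: "gromov x q (isom_inv g x) \<le> M"
    and far: "dist x (g x) > 2 * M + 3"
    using assms by (auto simp: transverse_def)
  have "dist x (isom_inv g x) = dist x (g x)" "dist q (isom_inv g x) = dist (g q) x"
    using \<Gamma>.dist_inv'[OF gG] by (simp_all add: dist_commute)
  then show ?thesis
    using 1 2 far four_point[of p "g x" "g q" x] \<Gamma>.iso[OF gG, of q x]
    by (simp add: gromov_def dist_commute field_simps max_def split: if_splits)
qed

text \<open>Bounds the number of transverse elements in one double class.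
  \<open>transverse_dist\<close> gives an estimate comparing \<open>dist x (g x)\<close> with
  \<open>dist x (g' x)\<close>; adding the one with the roles of \<open>g\<close> and
  \<open>g'\<close> exchanged cancels both.\<close>

lemma transverse_same_class:
  assumes g: "g \<in> transverse M" and g': "g' \<in> transverse M" and p: "p \<in> C"
    and hk: "h \<in> H" "k \<in> \<Gamma>\<^sub>0" "g' = h \<circ> g \<circ> k"
  shows "dist x (h x) + dist x (k x) \<le> 2 * dist x p + 4 * M + 6"
proof -
  have *: "dist x (h x) + dist x (k x) + dist x (g x) \<le> dist x (g' x) + 2 * dist x p + 4 * M + 6"
    if "g \<in> transverse M" "g' \<in> transverse M" "h \<in> H" "k \<in> \<Gamma>\<^sub>0" "g' = h \<circ> g \<circ> k" for g g' h k
  proof -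
    have "isom_inv h p \<in> C"
      using H_image[OF H.inv_mem[OF that(3)]] p by blast
    then have "dist x (isom_inv h p) + dist x (g x) + dist x (k x) - (4 * M + 6)
        \<le> dist (isom_inv h p) (g (k x))"
      using transverse_dist[OF that(1)] orbit_mem[OF that(4)] by blast
    also have "\<dots> = dist p (g' x)"
      using H.dist_inv[OF that(3)] that(5) by simp
    also have "\<dots> \<le> dist x p + dist x (g' x)"
      by (metis dist_commute dist_triangle)
    finally show ?thesis
      using H.dist_inv'[OF that(3), of x p] dist_triangle[of x "h x" p] by (simp add: dist_commute)
  qed
  have "g = isom_inv h \<circ> g' \<circ> isom_inv k"
    using hk by (simp add: fun_eq_iff)
  from *[OF g' g H.inv_mem[OF hk(1)] \<Gamma>\<^sub>0.inv_mem[OF hk(2)] this] *[OF g g' hk]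
  show ?thesis
    using H.dist_inv'[OF hk(1), of x x] \<Gamma>\<^sub>0.dist_inv'[OF hk(2), of x x] by (simp add: dist_commute)
qed

text \<open>Ping-pong on both sides turns every \<gamma> of large displacement into a transverse
  \<open>g = a \<circ> \<gamma> \<circ> isom_inv b\<close>. From the class of \<open>g\<close>, the
  elements \<open>a\<close>, \<open>b\<close> and a pair \<open>(h, k)\<close> in a finite set,
  \<gamma> can be recovered, so \<open>\<Psi>\<close> covers the orbit ball up to a finite
  part.\<close>

lemma classes_lower:
  "\<exists>c K N. \<forall>s. card (orbit_ball s) \<le> N + K * card (near_classes (s + c))"
proof -
  obtain A mA where A: "finite A" "A \<subseteq> \<Gamma>" "\<And>z. \<exists>a\<in>A. \<forall>p\<in>C. gromov x p (a z) \<le> mA"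
    using finite_ping_pong[OF escape] by metis
  obtain B mB where B: "finite B" "B \<subseteq> \<Gamma>" "\<And>z. \<exists>b\<in>B. \<forall>q\<in>C\<^sub>0. gromov x q (b z) \<le> mB"
    using finite_ping_pong[OF escape_from_hull] by metis
  define d where "d = Max (insert 0 ((\<lambda>a. dist x (a x)) ` (A \<union> B)))"
  have d: "dist x (a x) \<le> d" if "a \<in> A \<union> B" for a
    unfolding d_def using A B that by (intro Max_ge) auto
  \<comment> \<open>Ping-pong controls \<open>a (\<gamma> x)\<close> and
    \<open>b (isom_inv \<gamma> x)\<close>; these differ by at most \<open>d\<close> from
    \<open>g x\<close> and \<open>isom_inv g x\<close>.\<close>
  define M where "M = max mA mB + d"
  \<comment> \<open>Multiplying by \<open>a\<close> and \<open>isom_inv b\<close> changes the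
    displacement by at most \<open>2 * d\<close>, which must still leave more than
    \<open>2 * M + 3\<close>.\<close>
  define N where "N = 2 * M + 3 + 2 * d"
  obtain p0 where p0: "p0 \<in> C" using C_nonempty by blast
  define e where "e = dist x p0"
  define E where "E = orbit_ball (2 * e + 4 * M + 6)"
  define rep where "rep r = (SOME g. g \<in> r \<and> g \<in> transverse M)" for r
  define \<Psi> :: "('a \<Rightarrow> 'a) set \<times> ('a \<Rightarrow> 'a) \<times> ('a \<Rightarrow> 'a) \<times> ('a \<Rightarrow> 'a) \<times> ('a \<Rightarrow> 'a) \<Rightarrow> 'a \<Rightarrow> 'a"
    where "\<Psi> = (\<lambda>(r, a, b, h, k). isom_inv a \<circ> (h \<circ> rep r \<circ> k) \<circ> b)"
  \<comment> \<open>\<open>2 * d\<close> for the displacement of \<open>g\<close> compared with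
    \<gamma>, and \<open>e\<close> for measuring from \<open>p0\<close> in \<open>C\<close> in place
    of \<open>x\<close>.\<close>
  define c where "c = 2 * d + e"
  have cover: "orbit_ball s - orbit_ball N \<subseteq> \<Psi> ` (near_classes (s + c) \<times> A \<times> B \<times> E \<times> E)" for s
  proof
    fix \<gamma> assume "\<gamma> \<in> orbit_ball s - orbit_ball N"
    then have \<gamma>: "\<gamma> \<in> \<Gamma>" "dist x (\<gamma> x) \<le> s" "dist x (\<gamma> x) > N"
      by (auto simp: orbit_ball_def)
    obtain a where a: "a \<in> A" "\<And>p. p \<in> C \<Longrightarrow> gromov x p (a (\<gamma> x)) \<le> mA"
      using A(3) by blast
    obtain b where b: "b \<in> B" "\<And>q. q \<in> C\<^sub>0 \<Longrightarrow> gromov x q (b (isom_inv \<gamma> x)) \<le> mB"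
      using B(3) by blast
    have aG: "a \<in> \<Gamma>" and bG: "b \<in> \<Gamma>"
      using a b A B by auto
    define g where "g = a \<circ> \<gamma> \<circ> isom_inv b"
    have gG: "g \<in> \<Gamma>"
      unfolding g_def by (intro \<Gamma>.comp_mem aG \<gamma> \<Gamma>.inv_mem bG)
    have inv_g: "isom_inv g = b \<circ> isom_inv \<gamma> \<circ> isom_inv a"
      by (rule inv_unique_comp) (use aG bG \<gamma> in \<open>auto simp: g_def fun_eq_iff\<close>)
    have da: "dist x (a x) \<le> d" and db: "dist x (b x) \<le> d"
      using d a b by auto
    have move1: "dist (g x) (a (\<gamma> x)) \<le> d"
      using \<Gamma>.iso[OF aG] \<Gamma>.iso[OF \<gamma>(1)] \<Gamma>.dist_inv[OF bG, of x x] db by (simp add: g_def)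
    have move2: "dist (isom_inv g x) (b (isom_inv \<gamma> x)) \<le> d"
      using \<Gamma>.iso[OF bG] \<Gamma>.iso[OF \<Gamma>.inv_mem[OF \<gamma>(1)]] \<Gamma>.dist_inv[OF aG, of x x] da by (simp add: inv_g)
    have move3: "dist (a x) (a (\<gamma> x)) = dist x (\<gamma> x)"
      by (rule \<Gamma>.iso[OF aG])
    have len: "dist x (g x) \<le> s + 2 * d" "dist x (g x) > 2 * M + 3"
      using move1 move3 da \<gamma> dist_triangle[of x "a (\<gamma> x)" "a x"] dist_triangle[of x "g x" "a (\<gamma> x)"]
        dist_triangle[of "a x" "a (\<gamma> x)" x] dist_triangle[of x "a (\<gamma> x)" "g x"]
      by (auto simp: N_def dist_commute)
    have "gromov x p (g x) \<le> M" if "p \<in> C" for p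
      using gromov_change_point[of x "g x" p "a (\<gamma> x)"] move1 a(2)[OF that]
      unfolding M_def gromov_commute[of x p] by linarith
    moreover have "gromov x q (isom_inv g x) \<le> M" if "q \<in> C\<^sub>0" for q
      using gromov_change_point[of x "isom_inv g x" q "b (isom_inv \<gamma> x)"] move2 b(2)[OF that]
      unfolding M_def gromov_commute[of x q] by linarith
    ultimately have g: "g \<in> transverse M"
      using gG len by (auto simp: transverse_def)
    define r where "r = cls g"
    have "rep r \<in> r \<and> rep r \<in> transverse M"
      unfolding rep_def by (rule someI[of _ g]) (use g self_mem_cls in \<open>auto simp: r_def\<close>)
    then have rep: "rep r \<in> transverse M" and "cls (rep r) = cls g"
      using cls_eq by (auto simp: r_def)
    then have "g \<in> cls (rep r)"
      using self_mem_cls by simp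
    then obtain h k where hk: "h \<in> H" "k \<in> \<Gamma>\<^sub>0" "g = h \<circ> rep r \<circ> k"
      unfolding double_class_def by blast
    have "dist x (h x) + dist x (k x) \<le> 2 * e + 4 * M + 6"
      using transverse_same_class[OF rep g p0 hk] by (simp add: e_def)
    then have "h \<in> E" "k \<in> E"
      using hk H_sub sub zero_le_dist[of x "h x"] zero_le_dist[of x "k x"]
      unfolding E_def orbit_ball_def by (auto intro: order_trans[rotated])
    moreover have "r \<in> near_classes (s + c)"
    proof -
      have "cdist r \<le> dist p0 (g x)"
        unfolding r_def cdist_cls using p0 x_mem by (intro setdist_le_dist) auto
      also have "\<dots> \<le> s + c"
        using len dist_triangle[of p0 "g x" x] by (simp add: c_def e_def dist_commute)
      finally show ?thesis
        using gG by (simp add: near_classes_def r_def)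
    qed
    moreover have "\<gamma> = \<Psi> (r, a, b, h, k)"
    proof -
      have "\<gamma> = isom_inv a \<circ> g \<circ> b"
        using aG bG by (simp add: g_def fun_eq_iff)
      then show ?thesis by (simp add: \<Psi>_def hk(3))
    qed
    ultimately show "\<gamma> \<in> \<Psi> ` (near_classes (s + c) \<times> A \<times> B \<times> E \<times> E)"
      using a(1) b(1) by blast
  qed
  have "card (orbit_ball s) \<le> card (orbit_ball N) + card A * card B * card E * card E * card (near_classes (s + c))" for s
  proof -
    have fin: "finite (near_classes (s + c) \<times> A \<times> B \<times> E \<times> E)"
      using classes_upper(1) A B finite_orbit_ball by (auto simp: E_def)
    have "card (orbit_ball s) \<le> card (orbit_ball N \<union> (orbit_ball s - orbit_ball N))"
      using finite_orbit_ball by (intro card_mono) auto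
    also have "\<dots> \<le> card (orbit_ball N) + card (orbit_ball s - orbit_ball N)"
      by (rule card_Un_le)
    also have "card (orbit_ball s - orbit_ball N) \<le> card (near_classes (s + c) \<times> A \<times> B \<times> E \<times> E)"
      using cover fin by (meson card_image_le card_mono finite_imageI order_trans)
    also have "\<dots> = card A * card B * card E * card E * card (near_classes (s + c))"
      by (simp add: card_cartesian_product)
    finally show ?thesis by simp
  qed
  then show ?thesis by blast
qed

end

section \<open>From inequalities between counts to exponential growth\<close>

lemma same_growth_expI:
  fixes f :: "real \<Rightarrow> real"
  assumes "a > 0" "b > 0"
    and lower: "\<And>t. t \<ge> T \<Longrightarrow> a * exp (\<delta> * t) \<le> f t"
    and upper: "\<And>t. t \<ge> T \<Longrightarrow> f t \<le> b * exp (\<delta> * t)"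
  shows "f \<asymp> (\<lambda>t. exp (\<delta> * t))"
  unfolding same_growth_def
proof (intro exI conjI allI impI)
  define c where "c = max 1 (max b (1 / a))"
  show c: "c \<ge> 1" by (simp add: c_def)
  fix t assume t: "t \<ge> T"
  have "f t \<ge> 0"
    using lower[OF t] assms(1) by (intro order_trans[OF _ lower[OF t]]) simp
  have "f t \<le> c * exp (\<delta> * t)"
    by (rule order_trans[OF upper[OF t] mult_right_mono]) (auto simp: c_def)
  then show "1 / c * f t \<le> exp (\<delta> * t)"
    using c by (simp add: field_simps)
  have "exp (\<delta> * t) \<le> 1 / a * f t"
    using lower[OF t] assms(1) by (simp add: field_simps)
  also have "\<dots> \<le> c * f t"
    using \<open>f t \<ge> 0\<close> by (intro mult_right_mono) (auto simp: c_def)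
  finally show "exp (\<delta> * t) \<le> c * f t" .
qed

lemma (in isom_group) dist_orbit_change:
  assumes "g \<in> G"
  shows "dist p (g q) \<le> dist x (g x) + (dist p x + dist x q)"
    and "dist x (g x) \<le> dist p (g q) + (dist p x + dist x q)"
  using iso[OF assms, of x q] dist_triangle[of p "g q" x] dist_triangle[of x "g q" "g x"]
    dist_triangle[of x "g x" p] dist_triangle[of p "g x" "g q"]
  by (simp_all add: dist_commute)

text \<open>The cardinality of an infinite set is 0 by convention, so the positive lower bound on
  the orbit count forces finiteness for large radii, hence for all.\<close>

lemma (in isom_group) finite_of_growth:
  assumes "orbit_count G p q \<asymp> (\<lambda>t. exp (\<delta> * t))"
  shows "finite {g \<in> G. dist x (g x) \<le> t}"
proof -
  obtain c t0 where c: "c \<ge> 1" "\<And>s. s \<ge> t0 \<Longrightarrow> exp (\<delta> * s) \<le> c * orbit_count G p q s"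
    using assms unfolding same_growth_def by blast
  define s where "s = max t0 (t + (dist p x + dist x q))"
  have "0 < c * orbit_count G p q s"
    by (rule less_le_trans[OF exp_gt_zero c(2)]) (simp add: s_def)
  then have "orbit_count G p q s \<noteq> 0"
    by auto
  then have "finite {g \<in> G. dist p (g q) \<le> s}"
    unfolding orbit_count_def by (metis card.infinite of_nat_0)
  moreover have "{g \<in> G. dist x (g x) \<le> t} \<subseteq> {g \<in> G. dist p (g q) \<le> s}"
  proof
    fix g assume "g \<in> {g \<in> G. dist x (g x) \<le> t}"
    moreover have "t + (dist p x + dist x q) \<le> s"
      by (simp add: s_def)
    ultimately show "g \<in> {g \<in> G. dist p (g q) \<le> s}"
      using dist_orbit_change(1)[of g p q x] by simp
  qed
  ultimately show ?thesis by (rule finite_subset[rotated])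
qed

context double_class_count
begin

text \<open>Serves to absorb the additive constants of \<open>classes_upper\<close> and
  \<open>classes_lower\<close> into multiplicative ones, whatever the sign of \<delta>.\<close>

lemma orbit_ball_eventually_large: "\<exists>s\<^sub>0. \<forall>s\<ge>s\<^sub>0. N \<le> card (orbit_ball s)"
proof -
  have "infinite \<Gamma>"
    using infinite_index by auto
  then obtain J where J: "J \<subseteq> \<Gamma>" "finite J" "card J = N"
    using infinite_arbitrarily_large by blast
  define s0 where "s0 = Max (insert 0 ((\<lambda>g. dist x (g x)) ` J))"
  have "N \<le> card (orbit_ball s)" if s: "s \<ge> s0" for s
  proof -
    have "dist x (g x) \<le> s" if "g \<in> J" for g
    proof -
      have "dist x (g x) \<le> s0"
        unfolding s0_def using J that by (intro Max_ge) auto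
      with s show ?thesis by simp
    qed
    then have "J \<subseteq> orbit_ball s"
      using J by (auto simp: orbit_ball_def)
    then show ?thesis
      using card_mono[OF finite_orbit_ball] J(3) by metis
  qed
  then show ?thesis by blast
qed

lemma near_classes_growth:
  assumes growth: "orbit_count \<Gamma> p q \<asymp> (\<lambda>t. exp (\<delta> * t))"
  shows "(\<lambda>t. real (card (near_classes t))) \<asymp> (\<lambda>t. exp (\<delta> * t))"
proof -
  obtain c0 t0 where c0: "c0 \<ge> 1"
    and up: "\<And>t. t \<ge> t0 \<Longrightarrow> 1 / c0 * orbit_count \<Gamma> p q t \<le> exp (\<delta> * t)"
    and low: "\<And>t. t \<ge> t0 \<Longrightarrow> exp (\<delta> * t) \<le> c0 * orbit_count \<Gamma> p q t"
    using growth unfolding same_growth_def by blast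
  define e where "e = dist p x + dist x q"
  have ball_sup: "{g \<in> \<Gamma>. dist p (g q) \<le> t} \<subseteq> orbit_ball (t + e)" for t
  proof
    fix g assume "g \<in> {g \<in> \<Gamma>. dist p (g q) \<le> t}"
    then show "g \<in> orbit_ball (t + e)"
      using \<Gamma>.dist_orbit_change(2)[of g x p q] by (simp add: orbit_ball_def e_def)
  qed
  have ball_sub: "orbit_ball t \<subseteq> {g \<in> \<Gamma>. dist p (g q) \<le> t + e}" for t
  proof
    fix g assume "g \<in> orbit_ball t"
    then show "g \<in> {g \<in> \<Gamma>. dist p (g q) \<le> t + e}"
      using \<Gamma>.dist_orbit_change(1)[of g p q x] by (simp add: orbit_ball_def e_def)
  qed
  have fin: "finite {g \<in> \<Gamma>. dist p (g q) \<le> t}" for t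
  proof (rule finite_subset[OF _ finite_orbit_ball])
    show "{g \<in> \<Gamma>. dist p (g q) \<le> t} \<subseteq> orbit_ball (t + e)"
      by (rule ball_sup)
  qed
  have ball_up: "real (card (orbit_ball t)) \<le> c0 * exp (\<delta> * (t + e))" if "t + e \<ge> t0" for t
  proof -
    have "real (card (orbit_ball t)) \<le> orbit_count \<Gamma> p q (t + e)"
      unfolding orbit_count_def of_nat_le_iff by (rule card_mono[OF fin ball_sub])
    also have "\<dots> \<le> c0 * exp (\<delta> * (t + e))"
      using up[OF that] c0 by (simp add: field_simps)
    finally show ?thesis .
  qed
  have ball_low: "exp (\<delta> * (t - e)) \<le> c0 * real (card (orbit_ball t))" if "t - e \<ge> t0" for t
  proof -
    have "{g \<in> \<Gamma>. dist p (g q) \<le> t - e} \<subseteq> orbit_ball t"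
      using ball_sup[of "t - e"] by simp
    then have "orbit_count \<Gamma> p q (t - e) \<le> real (card (orbit_ball t))"
      unfolding orbit_count_def of_nat_le_iff by (rule card_mono[OF finite_orbit_ball])
    then have "c0 * orbit_count \<Gamma> p q (t - e) \<le> c0 * real (card (orbit_ball t))"
      using c0 by (intro mult_left_mono) auto
    with low[OF that] show ?thesis by linarith
  qed
  define c1 where "c1 = 1 + R + R'"
  obtain c2 :: real and K N :: nat where c2: "\<And>s. card (orbit_ball s) \<le> N + K * card (near_classes (s + c2))"
    using classes_lower by blast
  obtain s0 where s0: "\<And>s. s \<ge> s0 \<Longrightarrow> 2 * N \<le> card (orbit_ball s)"
    using orbit_ball_eventually_large by blast
  obtain s1 where s1: "\<And>s. s \<ge> s1 \<Longrightarrow> 1 \<le> card (orbit_ball s)"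
    using orbit_ball_eventually_large by blast
  \<comment> \<open>The factor 2 comes from absorbing \<open>N\<close> into half of the orbit count;
    \<open>K + 1\<close> keeps the denominator positive.\<close>
  define a where "a = exp (- \<delta> * (c2 + e)) / (2 * (real K + 1) * c0)"
  define b where "b = (real (card meeting) + 1) * c0 * exp (\<delta> * (c1 + e))"
  define T where "T = Max {t0 - c1 - e, s1 - c1, t0 + e + c2, s0 + c2}"
  show ?thesis
  proof (rule same_growth_expI)
    show "a > 0" "b > 0"
      using c0 by (auto simp: a_def b_def intro!: divide_pos_pos mult_pos_pos)
    fix t assume "t \<ge> T"
    then have t: "t \<ge> t0 - c1 - e" "t \<ge> s1 - c1" "t \<ge> t0 + e + c2" "t \<ge> s0 + c2"
      by (simp_all add: T_def)
    let ?n = "real (card (near_classes t))"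
    let ?B = "real (card (orbit_ball (t + c1)))"
    have "?n \<le> real (card meeting) + ?B"
      using classes_upper(2)[of t] unfolding c1_def by linarith
    also have "\<dots> \<le> (real (card meeting) + 1) * ?B"
      using s1[of "t + c1"] t mult_left_mono[of 1 ?B "real (card meeting)"] by (simp add: algebra_simps)
    also have "\<dots> \<le> (real (card meeting) + 1) * (c0 * exp (\<delta> * (t + c1 + e)))"
      using ball_up[of "t + c1"] t by (intro mult_left_mono) auto
    also have "\<dots> = b * exp (\<delta> * t)"
    proof -
      have "\<delta> * (t + c1 + e) = \<delta> * (c1 + e) + \<delta> * t"
        by (simp add: algebra_simps)
      then show ?thesis
        by (simp add: b_def exp_add)
    qed
    finally show "?n \<le> b * exp (\<delta> * t)" .
    let ?B' = "real (card (orbit_ball (t - c2)))"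
    have "?B' \<le> real N + real K * ?n"
    proof -
      have "card (orbit_ball (t - c2)) \<le> N + K * card (near_classes t)"
        using c2[of "t - c2"] by simp
      then have "?B' \<le> real (N + K * card (near_classes t))"
        by (rule of_nat_mono)
      then show ?thesis by simp
    qed
    moreover have "2 * real N \<le> ?B'"
    proof -
      have "2 * N \<le> card (orbit_ball (t - c2))"
        using t by (intro s0) simp
      then have "real (2 * N) \<le> ?B'"
        by (rule of_nat_mono)
      then show ?thesis by simp
    qed
    ultimately have "?B' \<le> 2 * (real K + 1) * ?n"
      by (simp add: algebra_simps)
    then have "c0 * ?B' \<le> c0 * (2 * (real K + 1) * ?n)"
      using c0 by (intro mult_left_mono) auto
    then have "exp (\<delta> * (t - c2 - e)) \<le> c0 * (2 * (real K + 1) * ?n)"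
      using ball_low[of "t - c2"] t by linarith
    moreover have "exp (\<delta> * (t - c2 - e)) = exp (- \<delta> * (c2 + e)) * exp (\<delta> * t)"
    proof -
      have "\<delta> * (t - c2 - e) = - \<delta> * (c2 + e) + \<delta> * t"
        by (simp add: algebra_simps)
      then show ?thesis by (simp only: exp_add)
    qed
    ultimately show "a * exp (\<delta> * t) \<le> ?n"
      using c0 by (simp add: a_def pos_divide_le_eq mult_ac)
  qed
qed

end

section \<open>Translation of the hypotheses into the counting setting\<close>

lemma rcosets_eq_right_cosets:
  "rcosets\<^bsub>isometry_group\<lparr>carrier := G\<rparr>\<^esub> K = right_coset K ` G"
  by (auto simp: RCOSETS_def r_coset_def right_coset_def isometry_group_def)

theorem mainTheorem6:
  fixes \<Gamma> \<Gamma>\<^sub>0 \<Gamma>inf :: "('a::heine_borel \<Rightarrow> 'a) set"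
    and C\<^sub>0 Cinf :: "'a set"
    and x y :: 'a
    and \<delta> :: real
  assumes "geodesic_space TYPE('a)"
    and "cat_minus_one TYPE('a)"
    and "subgroup \<Gamma> isometry_group"
    and "discrete_isometries \<Gamma>"
    and "critical_exponent \<Gamma> x y = ereal \<delta>"
    and "subgroup \<Gamma>\<^sub>0 (isometry_group\<lparr>carrier := \<Gamma>\<rparr>)"
    and "convex_cocompact \<Gamma>\<^sub>0"
    and "infinite (rcosets\<^bsub>isometry_group\<lparr>carrier := \<Gamma>\<rparr>\<^esub> \<Gamma>\<^sub>0)"
    and "C\<^sub>0 = limit_hull \<Gamma>\<^sub>0"
    and "Cinf \<noteq> {}"
    and "closed Cinf"
    and "geodesically_convex Cinf"
    and "\<Gamma>inf = set_stabilizer \<Gamma> Cinf"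
    and "\<not> limit_hull \<Gamma> \<subseteq> Cinf"
    and "compact_space (orbit_space \<Gamma>inf (frontier Cinf))"
    and "finite {r \<in> double_classes \<Gamma>inf \<Gamma> \<Gamma>\<^sub>0. \<exists>\<gamma>\<in>r. Cinf \<inter> \<gamma> ` C\<^sub>0 \<noteq> {}}"
    and "\<exists>p q. orbit_count \<Gamma> p q \<asymp> (\<lambda>t. exp (\<delta> * t))"
    and "critical_exponent \<Gamma>inf x y < ereal \<delta>"
  shows "(\<lambda>t. real (card {r \<in> double_classes \<Gamma>inf \<Gamma> \<Gamma>\<^sub>0. class_distance Cinf C\<^sub>0 r \<le> t}))
           \<asymp> (\<lambda>t. exp (\<delta> * t))"
proof -
  interpret cat_space "TYPE('a)"
    using assms(1,2) by unfold_locales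
  interpret G: isom_group \<Gamma>
    using subgroup_isom_group assms(3) by blast
  have "subgroup \<Gamma>\<^sub>0 isometry_group"
    using group.incl_subgroup[OF group_isometry_group assms(3,6)] .
  then interpret G0: isom_group \<Gamma>\<^sub>0
    by (rule subgroup_isom_group)
  have sub: "\<Gamma>\<^sub>0 \<subseteq> \<Gamma>"
    using subgroup.subset[OF assms(6)] by simp
  obtain p q where growth: "orbit_count \<Gamma> p q \<asymp> (\<lambda>t. exp (\<delta> * t))"
    using assms(17) by blast
  obtain \<xi> \<eta> where \<xi>: "\<xi> \<in> limit_set \<Gamma>\<^sub>0" "\<eta> \<in> limit_set \<Gamma>\<^sub>0" "\<xi> \<noteq> \<eta>"
    and compact: "compact_space (orbit_space \<Gamma>\<^sub>0 C\<^sub>0)"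
    using assms(7,9) unfolding convex_cocompact_def by blast
  \<comment> \<open>All estimates use a base point in the hull; the growth hypothesis concerns other
    points \<open>p\<close> and \<open>q\<close>, which changes radii only by a constant.\<close>
  obtain o' where o': "o' \<in> C\<^sub>0"
    using limit_hull_nonempty[OF \<xi>] assms(9) by blast
  obtain R where R: "\<And>p. p \<in> C\<^sub>0 \<Longrightarrow> \<exists>k\<in>\<Gamma>\<^sub>0. dist (k o') p \<le> R"
    using G0.cocompact_orbit_dense[OF compact, where x = o'] by metis
  interpret H: isom_group \<Gamma>inf
    unfolding assms(13) by (rule G.set_stabilizer_isom_group)
  obtain R' where R': "\<And>p. p \<in> frontier Cinf \<Longrightarrow> \<exists>h\<in>\<Gamma>inf. dist (h o') p \<le> R'"
    using H.cocompact_orbit_dense[OF assms(15), where x = o'] by metis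
  obtain m where m: "\<And>L. \<exists>g\<in>\<Gamma>. dist o' (g o') > L \<and> (\<forall>p\<in>Cinf. gromov o' p (g o') \<le> m)"
    using escape_from_convex[OF assms(11,12,10,14), where x = o'] by metis
  interpret double_class_count "TYPE('a)" \<Gamma> \<Gamma>\<^sub>0 C\<^sub>0 o' R Cinf \<Gamma>inf R' m
  proof unfold_locales
    show "finite {g \<in> \<Gamma>. dist o' (g o') \<le> t}" for t
      by (rule G.finite_of_growth[OF growth])
    \<comment> \<open>A limit point exists, and orbit points in its cone neighbourhoods lie
      arbitrarily far out.\<close>
    show "\<exists>k\<in>\<Gamma>\<^sub>0. dist o' (k o') > t" for t
    proof -
      have "\<xi> \<in> boundary_at_infinity"
        using \<xi>(1) by (simp add: limit_set_def)
      then obtain c where c: "c \<in> \<xi>"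
        by (rule boundary_cases)
      define r where "r = max 1 (t + dist (c 0) o')"
      have "r > 0" by (simp add: r_def)
      then obtain k where "k \<in> \<Gamma>\<^sub>0" "dist (c 0) (k o') > r"
        using limit_set_approach[OF \<xi>(1) c, of r o'] by blast
      then show ?thesis
        using dist_triangle[of "c 0" "k o'" o'] by (intro bexI[of _ k]) (auto simp: r_def)
    qed
    show "infinite (right_coset \<Gamma>\<^sub>0 ` \<Gamma>)"
      using assms(8) unfolding rcosets_eq_right_cosets .
    show "finite {r \<in> double_class \<Gamma>inf \<Gamma>\<^sub>0 ` \<Gamma>. \<exists>\<gamma>\<in>r. Cinf \<inter> \<gamma> ` C\<^sub>0 \<noteq> {}}"
      using assms(16) unfolding double_classes_eq .
    show "k ` C\<^sub>0 = C\<^sub>0" if "k \<in> \<Gamma>\<^sub>0" for k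
      unfolding assms(9) by (rule G0.limit_hull_image[OF that])
    show "geodesically_convex C\<^sub>0"
      unfolding assms(9) by (rule closed_convex_limit_hull)
  qed (fact sub o' R R' m assms(10,13))+
  show ?thesis
    using near_classes_growth[OF growth] unfolding near_classes_def double_classes_eq .
qed

end
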